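(* Let $n\ge 1$, let $\Omega\subset\mathbb{R}^n$ be a bounded open set with $C^{1,\gamma}$-boundary (for some $\gamma\in(0,1)$), and let $E\subset\mathbb{R}^n$ be a bounded measurable set with $\mathrm{Per}_{s_0}(E;\Omega)<\infty$ for some $s_0\in(0,1)$. Then the limit $\mu(E):=\lim_{s\searrow0}s\,\mathrm{Per}_s(E;\Omega)$ exists (that is, $E\in\mathcal{E}$) and $$\mu(E)=\mathcal{M}(E\cap\Omega).$$ In particular, if $E\subseteq\Omega$ and $\mathrm{Per}_{s_0}(E;\Omega)<\infty$ for some $s_0\in(0,1)$, then $\mu(E)=\mathcal{M}(E)$.
   Context: For $s\in(0,1)$ and measurable $A,B\subseteq\mathbb{R}^n$, set $L(A,B):=\int_A\int_B\frac{1}{|x-y|^{n+s}}\,dx\,dy\in[0,+\infty]$ (with $L(A,B)=0$ if $A$ or $B$ is empty). Write $\mathcal{C}E=\mathbb{R}^n\setminus E$. The $s$-perimeter of a measurable set $E\subseteq\mathbb{R}^n$ in $\Omega$ is $$\mathrm{Per}_s(E;\Omega):=L(E\cap\Omega,(\mathcal{C}E)\cap\Omega)+L(E\cap\Omega,(\mathcal{C}E)\cap(\mathcal{C}\Omega))+L(E\cap(\mathcal{C}\Omega),(\mathcal{C}E)\cap\Omega).$$ $\mathcal{E}$ denotes the family of sets $E\subseteq\mathbb{R}^n$ for which the limit $\mu(E):=\lim_{s\searrow0}s\,\mathrm{Per}_s(E;\Omega)$ exists (as a finite number). $\mathcal{H}^{n-1}(S^{n-1})$ is the $(n-1)$-dimensional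 Hausdorff measure of the unit sphere of $\mathbb{R}^n$, $|A|$ is the Lebesgue measure of $A$, and $\mathcal{M}(A):=\mathcal{H}^{n-1}(S^{n-1})\,|A|$. *)

theory Defs
  imports "HOL-Analysis.Analysis"
begin

text \<open>
  Hausdorff measure of integer dimension \<open>k\<close>, normalised so that it agrees with Lebesgue
  measure on \<open>\<real>\<^sup>k\<close>. An empty covering set contributes nothing even for \<open>k = 0\<close>, so that the
  \<open>0\<close>-dimensional measure is the counting measure. Covering sets have to be bounded because
  \<^const>\<open>diameter\<close> is unspecified on unbounded sets.
\<close>

definition hausdorff_content :: "real \<Rightarrow> nat \<Rightarrow> 'a::metric_space set \<Rightarrow> ennreal" where
  "hausdorff_content \<delta> k A =
     (INF U\<in>{U :: nat \<Rightarrow> 'a set.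
               A \<subseteq> (\<Union>i. U i) \<and> (\<forall>i. bounded (U i) \<and> diameter (U i) \<le> \<delta>)}.
        \<Sum>i. if U i = {} then 0
             else ennreal (unit_ball_vol (real k) * (diameter (U i) / 2) ^ k))"

definition hausdorff_measure :: "nat \<Rightarrow> 'a::metric_space set \<Rightarrow> ennreal" where
  "hausdorff_measure k A = (SUP \<delta>\<in>{0<..}. hausdorff_content \<delta> k A)"

text \<open>
  The value of the kernel on the diagonal is \<open>0\<close> here (division by zero); the diagonal is a
  null set, so this does not affect the integral.
\<close>

definition interaction :: "real \<Rightarrow> 'a::euclidean_space set \<Rightarrow> 'a set \<Rightarrow> ennreal" where
  "interaction s A B =
     (\<integral>\<^sup>+x\<in>A. (\<integral>\<^sup>+y\<in>B. ennreal (1 / norm (x - y) powr (real DIM('a) + s)) \<partial>lebesgue) \<partial>lebesgue)"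

definition s_perimeter :: "real \<Rightarrow> 'a::euclidean_space set \<Rightarrow> 'a set \<Rightarrow> ennreal" where
  "s_perimeter s E \<Omega> =
     interaction s (E \<inter> \<Omega>) (- E \<inter> \<Omega>)
     + interaction s (E \<inter> \<Omega>) (- E \<inter> - \<Omega>)
     + interaction s (E \<inter> - \<Omega>) (- E \<inter> \<Omega>)"

text \<open>
  \<open>limit_class \<Omega>\<close> consists of the measurable sets for which \<open>s * s_perimeter s E \<Omega>\<close> has a
  finite limit as \<open>s\<close> decreases to \<open>0\<close>; \<open>limit_perimeter \<Omega> E\<close> is meaningful only for such sets.
\<close>

definition limit_class :: "'a::euclidean_space set \<Rightarrow> 'a set set" where
  "limit_class \<Omega> =
     {E \<in> sets lebesgue.
        \<exists>l<\<infinity>. ((\<lambda>s. ennreal s * s_perimeter s E \<Omega>) \<longlongrightarrow> l) (at_right 0)}"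

definition limit_perimeter :: "'a::euclidean_space set \<Rightarrow> 'a set \<Rightarrow> ennreal" where
  "limit_perimeter \<Omega> E = Lim (at_right 0) (\<lambda>s. ennreal s * s_perimeter s E \<Omega>)"

definition sphere_weighted_volume :: "'a::euclidean_space set \<Rightarrow> ennreal" where
  "sphere_weighted_volume A =
     hausdorff_measure (DIM('a) - 1) (sphere (0::'a) 1) * emeasure lebesgue A"

definition C1_holder :: "real \<Rightarrow> ('a::euclidean_space \<Rightarrow> real) \<Rightarrow> bool" where
  "C1_holder \<gamma> \<phi> \<longleftrightarrow>
     (\<exists>g C. (\<forall>x. (\<phi> has_derivative (\<lambda>h. g x \<bullet> h)) (at x)) \<and>
            (\<forall>x y. norm (g x - g y) \<le> C * norm (x - y) powr \<gamma>))"

text \<open>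
  Near each boundary point the set is the region above the graph of a \<open>C\<^sup>1\<^sup>,\<^sup>\<gamma>\<close> function in a
  suitable orthonormal frame with last axis \<open>\<nu>\<close>. A function on the hyperplane orthogonal to
  \<open>\<nu>\<close> is represented by a function on the whole space that is evaluated only at the orthogonal
  projection \<open>x - (x \<bullet> \<nu>) *\<^sub>R \<nu>\<close>; restricting to the hyperplane and composing with the projection
  both preserve \<open>C\<^sup>1\<^sup>,\<^sup>\<gamma>\<close> regularity. Requiring \<open>\<phi>\<close> to be \<open>C\<^sup>1\<^sup>,\<^sup>\<gamma>\<close> globally is no restriction: a
  local graph function extends by a cut-off after shrinking \<open>r\<close>. In dimension 1 the hyperplane is a point and the set is a
  half-line near each boundary point.
\<close>

definition C1_holder_boundary :: "real \<Rightarrow> 'a::euclidean_space set \<Rightarrow> bool" where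
  "C1_holder_boundary \<gamma> \<Omega> \<longleftrightarrow>
     (\<forall>p\<in>frontier \<Omega>. \<exists>r>0. \<exists>\<nu> \<phi>. norm \<nu> = 1 \<and> C1_holder \<gamma> \<phi> \<and>
        \<Omega> \<inter> ball p r = {x \<in> ball p r. x \<bullet> \<nu> > \<phi> (x - (x \<bullet> \<nu>) *\<^sub>R \<nu>)})"

end

theory Submission
  imports Defs
begin

text \<open>
  Choose \<open>\<rho> \<ge> 1\<close> larger than the diameter of \<open>E \<union> \<Omega>\<close>. For \<open>x \<in> E \<inter> \<Omega>\<close> every \<open>y\<close> at distance at
  least \<open>\<rho>\<close> from \<open>x\<close> lies outside both sets, and these \<open>y\<close> contribute exactly
  \<open>n v\<^sub>n \<rho> powr (- s) / s\<close> to the inner integral, where \<open>v\<^sub>n\<close> is the volume of the unit ball. On pairs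
  at distance at most \<open>\<rho>\<close> the kernel of exponent \<open>s < s\<^sub>0\<close> is at most \<open>\<rho>\<close> times the kernel of exponent
  \<open>s\<^sub>0\<close>, so everything else is at most \<open>\<rho>\<close> times the \<open>s\<^sub>0\<close>-perimeter. After multiplication by \<open>s\<close> only
  \<open>n v\<^sub>n |E \<inter> \<Omega>|\<close> survives.

  It remains to see that \<open>n v\<^sub>n\<close> is the Hausdorff measure of the unit sphere. A subset \<open>U\<close> of the sphere
  is measured by the volume of the cone over \<open>U\<close> with apex \<open>0\<close>. Small balls centred on the sphere cut
  out cones that contain a flat cone of almost the expected volume, and a Vitali covering by such balls
  bounds the Hausdorff measure from above. Conversely, the slices of the cone over a set \<open>U\<close> of small
  diameter orthogonal to a fixed \<open>a \<in> U\<close> have almost the diameter of \<open>U\<close>, up to scaling; Steiner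
  symmetrization in all directions orthogonal to \<open>a\<close> moves the cone into a flat cone without changing
  its volume, which bounds the Hausdorff measure from below.
\<close>

section \<open>Volume of flat cones\<close>

text \<open>\<open>lborel\<close> is the image of a product measure indexed by \<open>Basis\<close>,
  from which the factor for \<open>j\<close> is split off. The order with the line integral inside
  serves Steiner symmetrization; the order with the hyperplane integral inside serves volumes
  computed by slices.\<close>

lemma nn_integral_lborel_coordinate:
  fixes f :: "'a::euclidean_space \<Rightarrow> ennreal"
  assumes j: "j \<in> Basis" and f[measurable]: "f \<in> borel_measurable borel"
  defines "B \<equiv> Basis - {j} :: 'a set"
  shows "(\<integral>\<^sup>+x. f x \<partial>lborel) =
      (\<integral>\<^sup>+u. (\<integral>\<^sup>+t. f ((\<Sum>b\<in>B. u b *\<^sub>R b) + t *\<^sub>R j) \<partial>lborel) \<partial>Pi\<^sub>M B (\<lambda>_. lborel))" (is "_ = ?A")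
    and "(\<integral>\<^sup>+x. f x \<partial>lborel) =
      (\<integral>\<^sup>+t. (\<integral>\<^sup>+u. f ((\<Sum>b\<in>B. u b *\<^sub>R b) + t *\<^sub>R j) \<partial>Pi\<^sub>M B (\<lambda>_. lborel)) \<partial>lborel)" (is "_ = ?C")
proof -
  interpret product_sigma_finite "\<lambda>_. lborel"
    by standard
  define F where "F = (\<lambda>u. f (\<Sum>b\<in>Basis. u b *\<^sub>R b))"
  have Bas: "Basis = insert j B" and jB: "j \<notin> B" and finB: "finite B"
    using j by (auto simp: B_def)
  have F[measurable]: "F \<in> borel_measurable (Pi\<^sub>M (insert j B) (\<lambda>_. lborel))"
    unfolding F_def Bas[symmetric] by measurable
  have upd: "F (u(j := t)) = f ((\<Sum>b\<in>B. u b *\<^sub>R b) + t *\<^sub>R j)" for u t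
  proof -
    have "(\<Sum>b\<in>B. (u(j := t)) b *\<^sub>R b) = (\<Sum>b\<in>B. u b *\<^sub>R b)"
      using jB by (intro sum.cong) auto
    then show ?thesis
      using jB finB by (simp add: F_def Bas add.commute)
  qed
  have *: "(\<integral>\<^sup>+x. f x \<partial>lborel) = (\<integral>\<^sup>+u. F u \<partial>Pi\<^sub>M (insert j B) (\<lambda>_. lborel))"
    unfolding F_def Bas[symmetric] by (subst lborel_eq) (simp add: nn_integral_distr)
  show "(\<integral>\<^sup>+x. f x \<partial>lborel) = ?A"
    unfolding * by (subst product_nn_integral_insert[OF finB jB F]) (simp add: upd)
  show "(\<integral>\<^sup>+x. f x \<partial>lborel) = ?C"
    unfolding * by (subst product_nn_integral_insert_rev[OF finB jB F]) (simp add: upd)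
qed

text \<open>For a unit vector \<open>a\<close> this is a solid right circular cone with axis
  \<open>a\<close>, height \<open>h\<close> and slope \<open>c\<close>, without its apex. It is the
  comparison set of known volume for both bounds on the Hausdorff measure.\<close>

definition flat_cone :: "'a::euclidean_space \<Rightarrow> real \<Rightarrow> real \<Rightarrow> 'a set" where
  "flat_cone a c h = {x. 0 < x \<bullet> a \<and> x \<bullet> a \<le> h \<and> norm (x - (x \<bullet> a) *\<^sub>R a) \<le> c * (x \<bullet> a)}"

lemma flat_cone_measurable [measurable]: "flat_cone a c h \<in> sets borel"
  unfolding flat_cone_def by measurable

lemma inner_sum_Basis_coordinate:
  fixes i j :: "'a::euclidean_space"
  assumes "i \<in> Basis" "j \<in> Basis"
  shows "((\<Sum>b\<in>Basis - {j}. u b *\<^sub>R b) + t *\<^sub>R j) \<bullet> i = (if i = j then t else u i)"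
proof -
  have "(\<Sum>b\<in>Basis - {j}. u b *\<^sub>R b) \<bullet> i = (\<Sum>b\<in>Basis - {j}. if b = i then u b else 0)"
    unfolding inner_sum_left using assms by (intro sum.cong) (auto simp: inner_Basis)
  also have "\<dots> = (if i = j then 0 else u i)"
    using assms by (simp add: sum.delta)
  finally show ?thesis
    using assms by (auto simp: inner_add_left inner_Basis)
qed

text \<open>The slice at height \<open>t\<close> is a ball of radius \<open>c * t\<close> in
  dimension \<open>DIM('a) - 1\<close>; its volume is integrated over \<open>t\<close>.\<close>

lemma emeasure_flat_cone_Basis:
  fixes k :: "'a::euclidean_space"
  assumes k: "k \<in> Basis" and c: "0 < c" and h: "0 \<le> h"
  shows "emeasure lborel (flat_cone k c h) =
    ennreal (unit_ball_vol (real (DIM('a) - 1)) * c ^ (DIM('a) - 1) * h ^ DIM('a) / real DIM('a))"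
proof -
  define m where "m = DIM('a) - 1"
  have m: "DIM('a) = Suc m"
    using DIM_positive[where 'a='a] by (simp add: m_def)
  define B where "B = Basis - {k}"
  have cardB: "card B = m" "finite B"
    using k by (auto simp: B_def m)
  let ?P = "Pi\<^sub>M B (\<lambda>_. lborel :: real measure)"
  have norm: "norm (\<Sum>b\<in>B. u b *\<^sub>R b) = sqrt (\<Sum>b\<in>B. (u b)\<^sup>2)" for u
  proof -
    have "norm (\<Sum>b\<in>B. u b *\<^sub>R b) ^ 2 = (\<Sum>b\<in>B. norm (u b *\<^sub>R b) ^ 2)"
      by (intro norm_sum_Pythagorean) (auto simp: cardB B_def pairwise_def orthogonal_def inner_Basis)
    also have "\<dots> = (\<Sum>b\<in>B. (u b)\<^sup>2)"
      by (intro sum.cong) (auto simp: B_def)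
    finally show ?thesis
      by (intro real_sqrt_unique[symmetric]) auto
  qed
  have mem: "(\<Sum>b\<in>B. u b *\<^sub>R b) + t *\<^sub>R k \<in> flat_cone k c h \<longleftrightarrow>
      0 < t \<and> t \<le> h \<and> sqrt (\<Sum>b\<in>B. (u b)\<^sup>2) \<le> c * t" for u t
    using inner_sum_Basis_coordinate[OF k k, of u t]
    by (auto simp: flat_cone_def norm B_def[symmetric])
  have "emeasure lborel (flat_cone k c h) = (\<integral>\<^sup>+x. indicator (flat_cone k c h) x \<partial>lborel)"
    by simp
  also have "\<dots> = (\<integral>\<^sup>+t. (\<integral>\<^sup>+u. indicator (flat_cone k c h) ((\<Sum>b\<in>B. u b *\<^sub>R b) + t *\<^sub>R k) \<partial>?P) \<partial>lborel)"
    unfolding B_def by (rule nn_integral_lborel_coordinate(2)[OF k]) measurable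
  also have "\<dots> = (\<integral>\<^sup>+t. ennreal (unit_ball_vol (real m) * c ^ m * t ^ m) * indicator {0..h} t \<partial>lborel)"
  \<comment> \<open>In dimension 1 the right side is nonzero at \<open>t = 0\<close> because
    \<open>0 ^ 0 = 1\<close>, while the cone has no point at height 0. The integrands therefore
    agree only almost everywhere.\<close>
  proof (intro nn_integral_cong_AE)
    have "AE t in lborel. t \<noteq> (0::real)"
      by (rule AE_lborel_singleton)
    then show "AE t in lborel. (\<integral>\<^sup>+u. indicator (flat_cone k c h) ((\<Sum>b\<in>B. u b *\<^sub>R b) + t *\<^sub>R k) \<partial>?P)
        = ennreal (unit_ball_vol (real m) * c ^ m * t ^ m) * indicator {0..h} t"
    proof eventually_elim
      case (elim t)
      show ?case
      proof (cases "0 < t \<and> t \<le> h")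
        case True
        have "(\<integral>\<^sup>+u. indicator (flat_cone k c h) ((\<Sum>b\<in>B. u b *\<^sub>R b) + t *\<^sub>R k) \<partial>?P)
            = (\<integral>\<^sup>+u. indicator ({u. sqrt (\<Sum>i\<in>B. (u i)\<^sup>2) \<le> c * t} \<inter> space ?P) u \<partial>?P)"
          using True by (intro nn_integral_cong) (auto simp: indicator_def mem)
        also have "\<dots> = emeasure ?P ({u. sqrt (\<Sum>i\<in>B. (u i)\<^sup>2) \<le> c * t} \<inter> space ?P)"
          using cardB by (intro nn_integral_indicator) measurable
        also have "\<dots> = ennreal (unit_ball_vol (real m) * (c * t) ^ m)"
          using emeasure_cball_aux[OF cardB(2), of "c * t"] True c by (simp add: cardB)
        finally show ?thesis
          using True by (simp add: power_mult_distrib mult_ac)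
      next
        case False
        with elim show ?thesis
          by (auto simp: indicator_def mem)
      qed
    qed
  qed
  also have "\<dots> = ennreal (unit_ball_vol (real m) * c ^ m * h ^ Suc m / Suc m
      - unit_ball_vol (real m) * c ^ m * 0 ^ Suc m / Suc m)"
  proof (rule nn_integral_FTC_Icc)
    fix t :: real
    show "((\<lambda>t. unit_ball_vol (real m) * c ^ m * t ^ Suc m / Suc m) has_real_derivative
        unit_ball_vol (real m) * c ^ m * t ^ m) (at t)"
      using DERIV_cdivide[OF DERIV_cmult[OF DERIV_pow[of "Suc m" t UNIV]],
          of "unit_ball_vol (real m) * c ^ m" "real (Suc m)"]
      by (simp add: mult.assoc del: power_Suc of_nat_Suc)
  qed (use c h in auto)
  finally show ?thesis
    by (simp add: m)
qed

section \<open>Steiner symmetrization\<close>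

text \<open>For a basis vector \<open>j\<close> the coefficient \<open>t - x \<bullet> j\<close>
  makes \<open>t\<close> the \<open>j\<close>-coordinate of the moving point, so the value depends
  only on the line through \<open>x\<close> in direction \<open>j\<close>.\<close>

definition section_length :: "'a::euclidean_space \<Rightarrow> 'a set \<Rightarrow> 'a \<Rightarrow> ennreal" where
  "section_length j A x = emeasure lborel {t. x + (t - x \<bullet> j) *\<^sub>R j \<in> A}"

text \<open>The strict inequality makes every nonempty section have positive length.\<close>

definition steiner :: "'a::euclidean_space \<Rightarrow> 'a set \<Rightarrow> 'a set" where
  "steiner j A = {x. ennreal (2 * \<bar>x \<bullet> j\<bar>) < section_length j A x}"

lemma section_length_measurable [measurable]:
  fixes A :: "'a::euclidean_space set"
  assumes [measurable]: "A \<in> sets borel"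
  shows "section_length j A \<in> borel_measurable borel"
proof -
  have "section_length j A x = (\<integral>\<^sup>+t. indicator A (x + (t - x \<bullet> j) *\<^sub>R j) \<partial>lborel)" for x
  proof -
    have "{t. x + (t - x \<bullet> j) *\<^sub>R j \<in> A} \<in> sets borel"
      by measurable
    then have "section_length j A x = (\<integral>\<^sup>+t. indicator {t. x + (t - x \<bullet> j) *\<^sub>R j \<in> A} t \<partial>lborel)"
      by (simp add: section_length_def)
    then show ?thesis
      by (simp add: indicator_def)
  qed
  then have "section_length j A = (\<lambda>x. \<integral>\<^sup>+t. indicator A (x + (t - x \<bullet> j) *\<^sub>R j) \<partial>lborel)"
    by auto
  also have "\<dots> \<in> borel_measurable borel"
    by measurable
  finally show ?thesis .
qed

lemma steiner_measurable [measurable]: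
  fixes A :: "'a::euclidean_space set"
  assumes [measurable]: "A \<in> sets borel"
  shows "steiner j A \<in> sets borel"
  unfolding steiner_def by measurable

lemma section_length_shift:
  fixes A :: "'a::euclidean_space set"
  assumes j: "j \<in> Basis"
  shows "section_length j A (x + r *\<^sub>R j) = section_length j A x"
  unfolding section_length_def using j by (simp add: inner_add_left algebra_simps)

text \<open>On each line parallel to \<open>j\<close> the section is replaced by a centred open
  interval of the same length, or by the whole line if that length is infinite. Fubini then compares
  the volumes.\<close>

lemma emeasure_steiner:
  fixes A :: "'a::euclidean_space set"
  assumes j: "j \<in> Basis" and A[measurable]: "A \<in> sets borel"
  shows "emeasure lborel (steiner j A) = emeasure lborel A"
proof -
  define B where "B = Basis - {j}"
  define y where "y = (\<lambda>u. \<Sum>b\<in>B. u b *\<^sub>R b)"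
  have y0: "y u \<bullet> j = 0" for u
    using inner_sum_Basis_coordinate[OF j j, of u 0] by (simp add: B_def y_def)
  have fub: "emeasure lborel C = (\<integral>\<^sup>+u. section_length j C (y u) \<partial>Pi\<^sub>M B (\<lambda>_. lborel))"
    if [measurable]: "C \<in> sets borel" for C
  proof -
    have "emeasure lborel C = (\<integral>\<^sup>+x. indicator C x \<partial>lborel)"
      by simp
    also have "\<dots> = (\<integral>\<^sup>+u. (\<integral>\<^sup>+t. indicator C (y u + t *\<^sub>R j) \<partial>lborel) \<partial>Pi\<^sub>M B (\<lambda>_. lborel))"
      unfolding B_def y_def by (rule nn_integral_lborel_coordinate(1)[OF j]) measurable
    also have "\<dots> = (\<integral>\<^sup>+u. (\<integral>\<^sup>+t. indicator {t. y u + t *\<^sub>R j \<in> C} t \<partial>lborel) \<partial>Pi\<^sub>M B (\<lambda>_. lborel))"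
      by (simp add: indicator_def)
    also have "\<dots> = (\<integral>\<^sup>+u. section_length j C (y u) \<partial>Pi\<^sub>M B (\<lambda>_. lborel))"
    proof (intro nn_integral_cong)
      fix u
      have "{t. y u + t *\<^sub>R j \<in> C} \<in> sets borel"
        by measurable
      then show "(\<integral>\<^sup>+t. indicator {t. y u + t *\<^sub>R j \<in> C} t \<partial>lborel) = section_length j C (y u)"
        by (simp add: section_length_def y0)
    qed
    finally show ?thesis .
  qed
  have "section_length j (steiner j A) x = section_length j A x" for x
  proof -
    let ?m = "section_length j A x"
    have "x + (t - x \<bullet> j) *\<^sub>R j \<in> steiner j A \<longleftrightarrow> ennreal (2 * \<bar>t\<bar>) < ?m" for t
      using j by (simp add: steiner_def section_length_shift inner_add_left)
    then have eq: "section_length j (steiner j A) x = emeasure lborel {t. ennreal (2 * \<bar>t\<bar>) < ?m}"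
      by (simp add: section_length_def)
    show ?thesis
    proof (cases ?m)
      case (real r)
      then have "{t. ennreal (2 * \<bar>t\<bar>) < ?m} = {- (r/2)<..<r/2}"
        by (auto simp: ennreal_less_iff)
      then show ?thesis
        using real by (simp add: eq)
    next
      case top
      then have "{t. ennreal (2 * \<bar>t\<bar>) < ?m} = UNIV"
        by auto
      then show ?thesis
        by (simp add: eq top)
    qed
  qed
  then show ?thesis
    by (simp add: fub)
qed

section \<open>Sets with slices of bounded diameter under Steiner symmetrization\<close>

text \<open>The hypothesis bounds both \<open>Sup I - Inf J\<close> and \<open>Sup J - Inf I\<close>
  by \<open>D\<close>. Their sum is also the sum of the lengths of the intervals spanned by
  \<open>I\<close> and by \<open>J\<close>.\<close>

lemma emeasure_add_le_of_abs_diff_le: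
  fixes I J :: "real set"
  assumes "I \<noteq> {}" "J \<noteq> {}" and D: "\<And>s t. s \<in> I \<Longrightarrow> t \<in> J \<Longrightarrow> \<bar>s - t\<bar> \<le> D"
  shows "emeasure lborel I + emeasure lborel J \<le> ennreal (2 * D)"
proof -
  obtain s0 t0 where st: "s0 \<in> I" "t0 \<in> J"
    using assms by blast
  have bI: "bdd_below I" "bdd_above I"
    using D[OF _ st(2)]
    by (auto intro!: bdd_belowI[of _ "t0 - D"] bdd_aboveI[of _ "t0 + D"]) (smt (verit))+
  have bJ: "bdd_below J" "bdd_above J"
    using D[OF st(1)]
    by (auto intro!: bdd_belowI[of _ "s0 - D"] bdd_aboveI[of _ "s0 + D"]) (smt (verit))+
  have "s - D \<le> Inf J" if "s \<in> I" for s
    using D[OF that] by (intro cInf_greatest[OF assms(2)]) (smt (verit))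
  then have 1: "Sup I \<le> Inf J + D"
    by (intro cSup_least[OF assms(1)]) (smt (verit))
  have "t - D \<le> Inf I" if "t \<in> J" for t
    using D[OF _ that] by (intro cInf_greatest[OF assms(1)]) (smt (verit))
  then have 2: "Sup J \<le> Inf I + D"
    by (intro cSup_least[OF assms(2)]) (smt (verit))
  have le: "Inf I \<le> Sup I" "Inf J \<le> Sup J"
    using bI bJ assms by (auto intro: cInf_le_cSup)
  have "emeasure lborel I \<le> emeasure lborel {Inf I..Sup I}"
    using bI by (intro emeasure_mono) (auto intro: cInf_lower cSup_upper)
  moreover have "emeasure lborel J \<le> emeasure lborel {Inf J..Sup J}"
    using bJ by (intro emeasure_mono) (auto intro: cInf_lower cSup_upper)
  ultimately have "emeasure lborel I + emeasure lborel J \<le> ennreal (Sup I - Inf I) + ennreal (Sup J - Inf J)"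
    using le by (intro add_mono) auto
  also have "\<dots> = ennreal ((Sup I - Inf I) + (Sup J - Inf J))"
    using le by (intro ennreal_plus[symmetric]) auto
  also have "\<dots> \<le> ennreal (2 * D)"
    using 1 2 by (intro ennreal_leI) linarith
  finally show ?thesis .
qed

text \<open>Of a cone with axis \<open>k\<close> only the range of heights and the diameters of the
  slices are recorded; symmetrization orthogonal to \<open>k\<close> preserves these bounds.\<close>

definition narrow :: "'a::euclidean_space \<Rightarrow> real \<Rightarrow> real \<Rightarrow> 'a set \<Rightarrow> bool" where
  "narrow k c h A \<longleftrightarrow> (\<forall>x\<in>A. 0 < x \<bullet> k \<and> x \<bullet> k \<le> h) \<and>
     (\<forall>x\<in>A. \<forall>y\<in>A. x \<bullet> k = y \<bullet> k \<longrightarrow> norm (x - y) \<le> c * (x \<bullet> k))"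

lemma steiner_section_nonempty:
  assumes "x \<in> steiner j A"
  shows "{t. x + (t - x \<bullet> j) *\<^sub>R j \<in> A} \<noteq> {}"
proof
  assume "{t. x + (t - x \<bullet> j) *\<^sub>R j \<in> A} = {}"
  then have "section_length j A x = 0"
    by (simp add: section_length_def)
  with assms show False
    by (simp add: steiner_def)
qed

text \<open>Heights along \<open>k\<close> do not change because \<open>j\<close> is orthogonal to
  \<open>k\<close>. If \<open>x\<close> and \<open>y\<close> in one symmetrized slice were too far
  apart, points of \<open>A\<close> on their two lines would have \<open>j\<close>-coordinates
  differing by at most \<open>D\<close>, so the two sections would have total length at most
  \<open>2 * D\<close>. Membership in \<open>steiner j A\<close> makes that total exceed twice the
  sum of the absolute \<open>j\<close>-coordinates of \<open>x\<close> and \<open>y\<close>, which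
  is at least \<open>2 * D\<close>.\<close>

lemma narrow_steiner:
  fixes A :: "'a::euclidean_space set"
  assumes jk: "j \<in> Basis" "k \<in> Basis" "j \<noteq> k" and A: "narrow k c h A"
  shows "narrow k c h (steiner j A)"
proof -
  have jk0: "j \<bullet> k = 0" "j \<bullet> j = 1"
    using jk by (auto simp: inner_Basis)
  have k_eq: "(x + r *\<^sub>R j) \<bullet> k = x \<bullet> k" for x r
    by (simp add: inner_add_left jk0)
  have "0 < x \<bullet> k \<and> x \<bullet> k \<le> h" if x: "x \<in> steiner j A" for x
    using steiner_section_nonempty[OF x] A k_eq[of x] by (fastforce simp: narrow_def)
  moreover have "norm (x - y) \<le> c * (x \<bullet> k)"
    if x: "x \<in> steiner j A" and y: "y \<in> steiner j A" and xy: "x \<bullet> k = y \<bullet> k" for x y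
  proof (rule ccontr)
    assume contra: "\<not> norm (x - y) \<le> c * (x \<bullet> k)"
    define I where "I = {t. x + (t - x \<bullet> j) *\<^sub>R j \<in> A}"
    define J where "J = {t. y + (t - y \<bullet> j) *\<^sub>R j \<in> A}"
    define D where "D = \<bar>x \<bullet> j - y \<bullet> j\<bar>"
    \<comment> \<open>\<open>z\<close> is the part of \<open>x - y\<close> orthogonal to
      \<open>j\<close>. All pairs of points on the two lines share it, so by Pythagoras comparing
      their distances means comparing differences of \<open>j\<close>-coordinates.\<close>
    define z where "z = x - y - ((x - y) \<bullet> j) *\<^sub>R j"
    have orth: "norm (z + r *\<^sub>R j) ^ 2 = norm z ^ 2 + r ^ 2" for r
    proof -
      have "z \<bullet> j = 0"
        by (simp add: z_def inner_diff_left jk0)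
      then show ?thesis
        unfolding power2_norm_eq_inner by (simp add: inner_add inner_commute jk0 power2_eq_square)
    qed
    have "\<bar>s - t\<bar> \<le> D" if st: "s \<in> I" "t \<in> J" for s t
    proof -
      define p where "p = x + (s - x \<bullet> j) *\<^sub>R j"
      define q where "q = y + (t - y \<bullet> j) *\<^sub>R j"
      have pq: "p \<in> A" "q \<in> A"
        using st by (auto simp: I_def J_def p_def q_def)
      have pk: "p \<bullet> k = x \<bullet> k" "q \<bullet> k = y \<bullet> k"
        unfolding p_def q_def by (rule k_eq)+
      then have "norm (p - q) \<le> c * (x \<bullet> k)"
        using A pq xy unfolding narrow_def by metis
      then have "norm (p - q) \<le> norm (x - y)"
        using contra by simp
      moreover have "p - q = z + (s - t) *\<^sub>R j"
        by (simp add: p_def q_def z_def algebra_simps inner_diff_left)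
      moreover have "x - y = z + (x \<bullet> j - y \<bullet> j) *\<^sub>R j"
        by (simp add: z_def algebra_simps inner_diff_left)
      ultimately have "norm (z + (s - t) *\<^sub>R j) ^ 2 \<le> norm (z + (x \<bullet> j - y \<bullet> j) *\<^sub>R j) ^ 2"
        by (metis norm_ge_zero power_mono)
      then have "(s - t)\<^sup>2 \<le> (x \<bullet> j - y \<bullet> j)\<^sup>2"
        by (simp add: orth)
      then show ?thesis
        by (simp add: D_def abs_le_square_iff)
    qed
    moreover have "I \<noteq> {}" "J \<noteq> {}"
      using steiner_section_nonempty x y unfolding I_def J_def by blast+
    ultimately have "emeasure lborel I + emeasure lborel J \<le> ennreal (2 * D)"
      by (intro emeasure_add_le_of_abs_diff_le) auto
    moreover have "ennreal (2 * D) \<le> ennreal (2 * \<bar>x \<bullet> j\<bar> + 2 * \<bar>y \<bullet> j\<bar>)"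
      using abs_triangle_ineq4[of "x \<bullet> j" "y \<bullet> j"] by (intro ennreal_leI) (simp add: D_def)
    moreover have "ennreal (2 * \<bar>x \<bullet> j\<bar> + 2 * \<bar>y \<bullet> j\<bar>) < emeasure lborel I + emeasure lborel J"
      using x y by (simp add: steiner_def section_length_def I_def J_def add_strict_mono)
    ultimately show False
      by (meson leD order.trans)
  qed
  ultimately show ?thesis
    by (simp add: narrow_def)
qed

section \<open>Reflection symmetries and comparison with a flat cone\<close>

text \<open>For a unit vector \<open>i\<close> the map is the reflection in the hyperplane
  orthogonal to \<open>i\<close>. It is an involution, so this inclusion already makes
  \<open>A\<close> equal to its mirror image.\<close>

definition reflection_invariant :: "'a::euclidean_space \<Rightarrow> 'a set \<Rightarrow> bool" where
  "reflection_invariant i A \<longleftrightarrow> (\<forall>x\<in>A. x - (2 * (x \<bullet> i)) *\<^sub>R i \<in> A)"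

lemma reflection_invariant_steiner_self:
  fixes A :: "'a::euclidean_space set"
  assumes j: "j \<in> Basis"
  shows "reflection_invariant j (steiner j A)"
proof -
  have "x - (2 * (x \<bullet> j)) *\<^sub>R j \<in> steiner j A" if "x \<in> steiner j A" for x
    using that section_length_shift[OF j, of A x "- (2 * (x \<bullet> j))"] j
    by (simp add: steiner_def inner_diff_left)
  then show ?thesis
    by (simp add: reflection_invariant_def)
qed

text \<open>The reflection along \<open>i\<close> fixes \<open>j\<close>, so it permutes the lines
  in direction \<open>j\<close> and preserves section lengths. Hence later symmetrizations keep the
  symmetries already gained.\<close>

lemma reflection_invariant_steiner:
  fixes A :: "'a::euclidean_space set"
  assumes ij: "i \<in> Basis" "j \<in> Basis" "i \<noteq> j" and A: "reflection_invariant i A"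
  shows "reflection_invariant i (steiner j A)"
proof -
  have ij0: "i \<bullet> j = 0" "j \<bullet> i = 0" "i \<bullet> i = 1"
    using ij by (auto simp: inner_Basis)
  define \<rho> where "\<rho> = (\<lambda>x. x - (2 * (x \<bullet> i)) *\<^sub>R i)"
  have \<rho>\<rho>: "\<rho> (\<rho> x) = x" for x
    by (simp add: \<rho>_def inner_diff_left ij0)
  have mem: "\<rho> x \<in> A \<longleftrightarrow> x \<in> A" for x
    using A \<rho>\<rho> unfolding reflection_invariant_def by (metis \<rho>_def)
  have "\<rho> x + (t - \<rho> x \<bullet> j) *\<^sub>R j = \<rho> (x + (t - x \<bullet> j) *\<^sub>R j)" for x t
    by (simp add: \<rho>_def inner_diff_left inner_add_left ij0)
  then have "section_length j A (\<rho> x) = section_length j A x" for x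
    by (simp add: section_length_def mem)
  then have "\<rho> x \<in> steiner j A" if "x \<in> steiner j A" for x
    using that by (simp add: steiner_def) (simp add: \<rho>_def inner_diff_left ij0)
  then show ?thesis
    by (simp add: reflection_invariant_def \<rho>_def)
qed

text \<open>One symmetrization per direction in \<open>J\<close>, each preserving the volume, the
  slice bounds and the earlier reflections.\<close>

lemma exists_reflection_invariant:
  fixes A :: "'a::euclidean_space set"
  assumes "finite J" "J \<subseteq> Basis - {k}" and k: "k \<in> Basis"
    and A: "A \<in> sets borel" "narrow k c h A"
  shows "\<exists>A'\<in>sets borel. emeasure lborel A' = emeasure lborel A \<and> narrow k c h A' \<and>
      (\<forall>j\<in>J. reflection_invariant j A')"
  using assms(1,2)
proof (induction J)
  case empty
  then show ?case
    using A by auto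
next
  case (insert j J)
  then obtain A' where A': "A' \<in> sets borel" "emeasure lborel A' = emeasure lborel A" "narrow k c h A'"
    "\<forall>j\<in>J. reflection_invariant j A'"
    by auto
  have j: "j \<in> Basis" "j \<noteq> k"
    using insert.prems by auto
  have "reflection_invariant i (steiner j A')" if "i \<in> insert j J" for i
    using that A'(4) insert.prems insert.hyps
    by (cases "i = j")
      (auto intro!: reflection_invariant_steiner reflection_invariant_steiner_self)
  moreover have "steiner j A' \<in> sets borel"
    using A'(1) by measurable
  ultimately show ?case
    using A' j k by (intro bexI[of _ "steiner j A'"]) (auto simp: emeasure_steiner narrow_steiner)
qed

text \<open>The reflections are composed; each leaves the other coordinates alone. With
  \<open>J = Basis - {k}\<close> the composite is the point reflection of every slice in its centre
  on the axis \<open>k\<close>.\<close>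

lemma reflection_invariant_sum:
  fixes A :: "'a::euclidean_space set"
  assumes "finite J" "J \<subseteq> Basis" "\<forall>j\<in>J. reflection_invariant j A" "x \<in> A"
  shows "x - (\<Sum>j\<in>J. (2 * (x \<bullet> j)) *\<^sub>R j) \<in> A"
  using assms
proof (induction J)
  case (insert j J)
  let ?y = "x - (\<Sum>j\<in>J. (2 * (x \<bullet> j)) *\<^sub>R j)"
  have "(\<Sum>j\<in>J. (2 * (x \<bullet> j)) *\<^sub>R j) \<bullet> j = (\<Sum>i\<in>J. 0)"
    unfolding inner_sum_left
  proof (intro sum.cong refl)
    fix i assume "i \<in> J"
    then have "i \<in> Basis" "i \<noteq> j"
      using insert.prems insert.hyps by auto
    then show "(2 * (x \<bullet> i)) *\<^sub>R i \<bullet> j = 0"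
      using insert.prems by (simp add: inner_Basis)
  qed
  then have "?y \<bullet> j = x \<bullet> j"
    by (simp add: inner_diff_left)
  moreover have "?y - (2 * (?y \<bullet> j)) *\<^sub>R j \<in> A"
    using insert unfolding reflection_invariant_def by auto
  ultimately show ?case
    using insert.hyps by (simp add: algebra_simps)
qed simp

text \<open>An isodiametric inequality, applied simultaneously to all slices \<open>x \<bullet> k = const\<close>.\<close>

lemma narrow_rearrangement:
  fixes A :: "'a::euclidean_space set"
  assumes k: "k \<in> Basis" and A: "A \<in> sets borel" "narrow k c h A"
  shows "\<exists>A'\<in>sets borel. A' \<subseteq> flat_cone k (c / 2) h \<and> emeasure lborel A' = emeasure lborel A"
proof -
  obtain A' where A': "A' \<in> sets borel" "emeasure lborel A' = emeasure lborel A" "narrow k c h A'"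
    "\<forall>j\<in>Basis - {k}. reflection_invariant j A'"
    using exists_reflection_invariant[of "Basis - {k}" k A c h] k A by auto
  have "A' \<subseteq> flat_cone k (c / 2) h"
  proof
    fix x assume x: "x \<in> A'"
    \<comment> \<open>\<open>y\<close> is the mirror image of \<open>x\<close> in the axis spanned
      by \<open>k\<close>, at the same height. Their distance is twice the distance of
      \<open>x\<close> from the axis, which turns the diameter bound \<open>c\<close> into the
      radius bound \<open>c / 2\<close>.\<close>
    define y where "y = x - (\<Sum>j\<in>Basis - {k}. (2 * (x \<bullet> j)) *\<^sub>R j)"
    have y: "y \<in> A'"
      unfolding y_def using x A'(4) by (intro reflection_invariant_sum) auto
    have "x = (\<Sum>j\<in>Basis. (x \<bullet> j) *\<^sub>R j)"
      by (simp add: euclidean_representation)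
    also have "\<dots> = (x \<bullet> k) *\<^sub>R k + (\<Sum>j\<in>Basis - {k}. (x \<bullet> j) *\<^sub>R j)"
      using k by (simp add: sum.remove)
    finally have "x - (x \<bullet> k) *\<^sub>R k = (\<Sum>j\<in>Basis - {k}. (x \<bullet> j) *\<^sub>R j)"
      by (metis add_diff_cancel_left')
    then have xy: "x - y = 2 *\<^sub>R (x - (x \<bullet> k) *\<^sub>R k)"
      by (simp add: y_def scaleR_sum_right)
    then have "(x - y) \<bullet> k = 0"
      using k by (simp add: inner_diff_left)
    then have "x \<bullet> k = y \<bullet> k"
      by (simp add: inner_diff_left)
    with A'(3) x y have "norm (x - y) \<le> c * (x \<bullet> k)" "0 < x \<bullet> k" "x \<bullet> k \<le> h"
      by (auto simp: narrow_def)
    then show "x \<in> flat_cone k (c / 2) h"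
      unfolding xy by (simp add: flat_cone_def)
  qed
  with A' show ?thesis
    by blast
qed

lemma emeasure_narrow_le_Basis:
  fixes A :: "'a::euclidean_space set"
  assumes k: "k \<in> Basis" and A: "A \<in> sets borel" "narrow k c h A" and c: "0 \<le> c" and h: "0 \<le> h"
  shows "emeasure lborel A \<le>
    ennreal (unit_ball_vol (real (DIM('a) - 1)) * (c / 2) ^ (DIM('a) - 1) * h ^ DIM('a) / real DIM('a))"
    (is "_ \<le> ennreal (?V c)")
\<comment> \<open>The volume formula for flat cones asks for a positive slope, whereas
  \<open>c = 0\<close> is allowed here. The estimate is proved for all \<open>c' > c\<close> and
  passed to the limit.\<close>
proof (rule tendsto_lowerbound)
  show "((\<lambda>c'. ennreal (?V c')) \<longlongrightarrow> ennreal (?V c)) (at_right c)"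
    by (intro tendsto_intros) auto
  show "eventually (\<lambda>c'. emeasure lborel A \<le> ennreal (?V c')) (at_right c)"
    using eventually_at_right_less[of c]
  proof eventually_elim
    case (elim c')
    have "narrow k c' h A"
    proof -
      have *: "c * (x \<bullet> k) \<le> c' * (x \<bullet> k)" if "0 < x \<bullet> k" for x
        using elim that by simp
      show ?thesis
        unfolding narrow_def
      proof (intro conjI ballI impI)
        fix x y assume "x \<in> A" "y \<in> A" "x \<bullet> k = y \<bullet> k"
        with A(2) have "norm (x - y) \<le> c * (x \<bullet> k)" "0 < x \<bullet> k"
          unfolding narrow_def by blast+
        with * show "norm (x - y) \<le> c' * (x \<bullet> k)"
          by (meson order_trans)
      qed (use A(2) in \<open>auto simp: narrow_def\<close>)
    qed
    from narrow_rearrangement[OF k A(1) this]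
    obtain A' where A': "A' \<subseteq> flat_cone k (c' / 2) h" "emeasure lborel A' = emeasure lborel A"
      by auto
    have "emeasure lborel A' \<le> emeasure lborel (flat_cone k (c' / 2) h)"
      using A'(1) by (intro emeasure_mono) auto
    then have "emeasure lborel A \<le> emeasure lborel (flat_cone k (c' / 2) h)"
      by (simp add: A'(2))
    also have "\<dots> = ennreal (?V c')"
      using k c elim h by (intro emeasure_flat_cone_Basis) auto
    finally show ?case .
  qed
qed auto

section \<open>Rotation invariance of Lebesgue measure\<close>

text \<open>An orthogonal map sends balls to balls of the same radius, and by Vitali countably many
  disjoint balls fill \<open>S\<close> up to a null set. Only an inequality results, since nothing
  is said about the image of the null remainder.\<close>

lemma emeasure_orthogonal_image_open:
  fixes f :: "'a::euclidean_space \<Rightarrow> 'a"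
  assumes f: "orthogonal_transformation f" and S: "open S"
  shows "emeasure lborel S \<le> emeasure lborel (f ` S)"
proof -
  define K where "K = {p :: 'a \<times> real. 0 < snd p \<and> ball (fst p) (snd p) \<subseteq> S}"
  have K: "\<exists>i. i \<in> K \<and> x \<in> ball (fst i) (snd i) \<and> snd i < d" if xd: "x \<in> S" "0 < d" for x d
  proof -
    obtain e where "e > 0" "ball x e \<subseteq> S"
      using S xd open_contains_ball by blast
    then show ?thesis
      using xd by (intro exI[of _ "(x, min e (d / 2))"]) (auto simp: K_def)
  qed
  obtain C where C: "countable C" "C \<subseteq> K"
    "pairwise (\<lambda>i j. disjnt (ball (fst i) (snd i)) (ball (fst j) (snd j))) C"
    "negligible (S - (\<Union>i\<in>C. ball (fst i) (snd i)))"
    by (rule Vitali_covering_theorem_balls[OF K])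
  define U where "U = (\<Union>i\<in>C. ball (fst i) (snd i))"
  have openU: "open U"
    unfolding U_def by blast
  have inj: "inj f" "surj f"
    using orthogonal_transformation_bij[OF f] by (auto simp: bij_def)
  have fU: "f ` U = (\<Union>i\<in>C. ball (f (fst i)) (snd i))"
    by (simp add: U_def image_UN image_orthogonal_transformation_ball[OF f])
  have "emeasure lborel U = (\<integral>\<^sup>+i. emeasure lborel (ball (fst i) (snd i)) \<partial>count_space C)"
    unfolding U_def using C
    by (intro emeasure_UN_countable) (auto simp: disjoint_family_on_def pairwise_def disjnt_def)
  also have "\<dots> = (\<integral>\<^sup>+i. emeasure lborel (ball (f (fst i)) (snd i)) \<partial>count_space C)"
    using C(2) by (intro nn_integral_cong) (auto simp: emeasure_ball K_def)
  also have "\<dots> = emeasure lborel (f ` U)"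
    unfolding fU
  proof (intro emeasure_UN_countable[symmetric])
    have "f ` ball (fst i) (snd i) \<inter> f ` ball (fst j) (snd j) = {}" if "i \<in> C" "j \<in> C" "i \<noteq> j" for i j
      using C(3) that inj(1) by (simp add: image_Int[symmetric] pairwise_def disjnt_def)
    then show "disjoint_family_on (\<lambda>i. ball (f (fst i)) (snd i)) C"
      by (simp add: disjoint_family_on_def image_orthogonal_transformation_ball[OF f])
  qed (use C in auto)
  finally have U: "emeasure lborel U = emeasure lborel (f ` U)" .
  have "emeasure lborel S \<le> emeasure lborel (U \<union> (S - U))"
    using openU S by (intro emeasure_mono) auto
  also have "\<dots> \<le> emeasure lborel U + emeasure lborel (S - U)"
    using openU S by (intro emeasure_subadditive) auto
  also have "emeasure lborel (S - U) = 0"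
  proof -
    have "S - U \<in> sets lborel"
      using openU S by auto
    with C(4) show ?thesis
      unfolding U_def[symmetric] negligible_iff_null_sets by (simp add: null_sets_completion_iff null_setsD1)
  qed
  also have "emeasure lborel U + 0 \<le> emeasure lborel (f ` S)"
  proof -
    have "open (f ` S)"
      using S inj f by (simp add: orthogonal_transformation_linear open_surjective_linear_image)
    moreover have "f ` U \<subseteq> f ` S"
      using C(2) by (force simp: U_def K_def)
    ultimately show ?thesis
      by (simp add: U emeasure_mono)
  qed
  finally show ?thesis .
qed

text \<open>The inequality for open sets, applied to \<open>f\<close> and to its inverse, gives
  equality on open boxes, and these determine \<open>lborel\<close>.\<close>

lemma emeasure_orthogonal_image:
  fixes f :: "'a::euclidean_space \<Rightarrow> 'a"
  assumes f: "orthogonal_transformation f" and A: "A \<in> sets borel"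
  shows "emeasure lborel (f ` A) = emeasure lborel A"
proof -
  define g where "g = inv f"
  have bij: "bij f"
    by (simp add: f orthogonal_transformation_bij)
  have fg: "f (g x) = x" "g (f x) = x" for x
    using bij by (auto simp: g_def bij_def inv_f_f surj_f_inv_f)
  have g: "orthogonal_transformation g"
    by (simp add: g_def f orthogonal_transformation_inv)
  have [measurable]: "g \<in> borel_measurable borel" "f \<in> borel_measurable borel"
    using f g by (auto intro!: borel_measurable_continuous_onI linear_continuous_on
        simp: orthogonal_transformation_linear linear_conv_bounded_linear[symmetric])
  have im: "f ` S = g -` S" for S
    by (auto simp: fg) (metis fg(1) imageI)
  have "lborel = distr lborel borel g"
  proof (rule lborel_eqI)
    fix l u :: 'a
    assume lu: "\<And>b. b \<in> Basis \<Longrightarrow> l \<bullet> b \<le> u \<bullet> b"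
    have op: "open (f ` box l u)"
      using bij f by (intro open_surjective_linear_image) (auto simp: orthogonal_transformation_linear bij_def)
    have "emeasure lborel (f ` box l u) \<le> emeasure lborel (g ` f ` box l u)"
      by (rule emeasure_orthogonal_image_open[OF g op])
    also have "g ` f ` box l u = box l u"
      by (simp add: image_image fg)
    finally have "emeasure lborel (f ` box l u) = emeasure lborel (box l u)"
      using emeasure_orthogonal_image_open[OF f open_box[of l u]] by (rule antisym)
    then show "emeasure (distr lborel borel g) (box l u) = ennreal (\<Prod>b\<in>Basis. (u - l) \<bullet> b)"
      using lu by (simp add: emeasure_distr im)
  qed simp
  then have "emeasure lborel A = emeasure (distr lborel borel g) A"
    by simp
  also have "\<dots> = emeasure lborel (f ` A)"
    using A by (simp add: emeasure_distr im)
  finally show ?thesis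
    by simp
qed

text \<open>Carries the volume results for a coordinate axis over to an arbitrary axis
  \<open>a\<close>.\<close>

lemma exists_rotation_to_Basis:
  fixes a :: "real ^ 'n"
  assumes a: "norm a = 1"
  obtains f :: "real ^ 'n \<Rightarrow> real ^ 'n" and k where "orthogonal_transformation f" "f a = k" "k \<in> Basis"
proof -
  obtain k :: "real ^ 'n" where k: "k \<in> Basis"
    using SOME_Basis by blast
  then have "norm a = norm k"
    using a by simp
  then obtain f where "orthogonal_transformation f" "f a = k"
    by (rule orthogonal_transformation_exists)
  then show thesis
    using that k by simp
qed

lemma emeasure_flat_cone:
  fixes a :: "real ^ 'n"
  assumes a: "norm a = 1" and c: "0 < c" and h: "0 \<le> h"
  shows "emeasure lborel (flat_cone a c h) =
    ennreal (unit_ball_vol (real (CARD('n) - 1)) * c ^ (CARD('n) - 1) * h ^ CARD('n) / real CARD('n))"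
proof -
  obtain f :: "real ^ 'n \<Rightarrow> real ^ 'n" and k where f: "orthogonal_transformation f" "f a = k" "k \<in> Basis"
    using exists_rotation_to_Basis[OF a] .
  have lin: "linear f"
    by (simp add: f orthogonal_transformation_linear)
  have mem: "f x \<in> flat_cone k c h \<longleftrightarrow> x \<in> flat_cone a c h" for x
  proof -
    have "f x \<bullet> k = x \<bullet> a"
      using f by (auto simp: orthogonal_transformation_def)
    moreover from this have "norm (f x - (f x \<bullet> k) *\<^sub>R k) = norm (x - (x \<bullet> a) *\<^sub>R a)"
      using f orthogonal_transformation_norm[OF f(1), of "x - (x \<bullet> a) *\<^sub>R a"] lin
      by (simp add: linear_diff linear_scale)
    ultimately show ?thesis
      by (simp add: flat_cone_def)
  qed
  have "f ` flat_cone a c h = flat_cone k c h"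
    using mem bij_is_surj[OF orthogonal_transformation_bij[OF f(1)]] by (auto simp: surj_def) (metis image_eqI)
  then show ?thesis
    using emeasure_orthogonal_image[OF f(1) flat_cone_measurable[of a c h]]
      emeasure_flat_cone_Basis[OF f(3) c h] by simp
qed

lemma emeasure_narrow_le:
  fixes A :: "(real ^ 'n) set"
  assumes a: "norm a = 1" and A: "A \<in> sets borel" "narrow a c h A" and c: "0 \<le> c" and h: "0 \<le> h"
  shows "emeasure lborel A \<le>
    ennreal (unit_ball_vol (real (CARD('n) - 1)) * (c / 2) ^ (CARD('n) - 1) * h ^ CARD('n) / real CARD('n))"
proof -
  obtain f :: "real ^ 'n \<Rightarrow> real ^ 'n" and k where f: "orthogonal_transformation f" "f a = k" "k \<in> Basis"
    using exists_rotation_to_Basis[OF a] .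
  have lin: "linear f"
    by (simp add: f orthogonal_transformation_linear)
  have fk: "f x \<bullet> k = x \<bullet> a" for x
    using f by (auto simp: orthogonal_transformation_def)
  have fn: "norm (f x - f y) = norm (x - y)" for x y
    using orthogonal_transformation_norm[OF f(1), of "x - y"] lin by (simp add: linear_diff)
  have "narrow k c h (f ` A)"
    using A(2) by (simp add: narrow_def fk fn)
  moreover have "f ` A \<in> sets borel"
  proof -
    have bij: "bij f"
      by (simp add: f orthogonal_transformation_bij)
    have [measurable]: "inv f \<in> borel_measurable borel"
      using f by (auto intro!: borel_measurable_continuous_onI linear_continuous_on
        simp: orthogonal_transformation_linear orthogonal_transformation_inv linear_conv_bounded_linear[symmetric])
    have "inv f -` A \<inter> space borel \<in> sets borel"
      using A(1) by measurable
    then show ?thesis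
      using bij by (simp add: bij_vimage_eq_inv_image bij_imp_bij_inv inv_inv_eq)
  qed
  ultimately show ?thesis
    using emeasure_narrow_le_Basis[OF f(3) _ _ c h, of "f ` A"] emeasure_orthogonal_image[OF f(1) A(1)]
    by simp
qed

section \<open>Hausdorff measure of the unit sphere\<close>

text \<open>The dimension times the volume of this cone stands in for the surface measure of the
  part of \<open>U\<close> on the sphere. Without the apex, cones over disjoint sets are
  disjoint.\<close>

definition radial_cone :: "'a::euclidean_space set \<Rightarrow> 'a set" where
  "radial_cone U = {x. x \<noteq> 0 \<and> norm x \<le> 1 \<and> x /\<^sub>R norm x \<in> U}"

lemma radial_cone_measurable [measurable]:
  fixes U :: "'a::euclidean_space set"
  assumes [measurable]: "U \<in> sets borel"
  shows "radial_cone U \<in> sets borel"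
  unfolding radial_cone_def by measurable

text \<open>On the flat cone \<open>norm x\<close> is at most \<open>w = sqrt (1 + r^2)\<close>
  times the height, so the chosen height keeps the cone in the unit ball. The direction of
  \<open>x\<close> then has inner product at least \<open>1 / w\<close> with \<open>a\<close>, hence
  squared distance at most \<open>2 - 2 / w\<close> from \<open>a\<close>, and this is at most
  \<open>r^2\<close>.\<close>

lemma flat_cone_subset_radial_cone:
  fixes a :: "'a::euclidean_space"
  assumes a: "norm a = 1" and r: "0 < r"
  shows "flat_cone a r (1 / sqrt (1 + r\<^sup>2)) \<subseteq> radial_cone (cball a r)"
proof
  fix x assume "x \<in> flat_cone a r (1 / sqrt (1 + r\<^sup>2))"
  then have x: "0 < x \<bullet> a" "x \<bullet> a \<le> 1 / sqrt (1 + r\<^sup>2)" "norm (x - (x \<bullet> a) *\<^sub>R a) \<le> r * (x \<bullet> a)"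
    by (auto simp: flat_cone_def)
  define t where "t = x \<bullet> a"
  define w where "w = sqrt (1 + r\<^sup>2)"
  have w: "1 \<le> w" "w\<^sup>2 = 1 + r\<^sup>2"
    by (auto simp: w_def)
  have aa: "a \<bullet> a = 1"
    using a by (simp add: power2_norm_eq_inner[symmetric])
  have "(norm x)\<^sup>2 = t\<^sup>2 + (norm (x - t *\<^sub>R a))\<^sup>2"
    unfolding power2_norm_eq_inner
    by (simp add: inner_diff inner_commute t_def aa power2_eq_square)
  also have "\<dots> \<le> t\<^sup>2 + (r * t)\<^sup>2"
    using x by (intro add_left_mono power_mono) (auto simp: t_def)
  also have "\<dots> = (w * t)\<^sup>2"
    by (simp add: power_mult_distrib w(2) algebra_simps)
  finally have nx: "norm x \<le> w * t"
    using x w by (auto simp: t_def intro: power2_le_imp_le)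
  have "w * t \<le> 1"
    using x(2) w unfolding t_def[symmetric] w_def[symmetric] by (simp add: pos_le_divide_eq mult.commute)
  with nx have n1: "norm x \<le> 1"
    by simp
  have x0: "x \<noteq> 0" "0 < norm x"
    using x(1) by auto
  have "(norm (a - x /\<^sub>R norm x))\<^sup>2 = 2 - 2 * (t / norm x)"
    using x0 by (simp add: power2_norm_eq_inner inner_diff inner_commute t_def aa)
      (simp add: power2_norm_eq_inner[symmetric] power2_eq_square field_simps)
  also have "\<dots> \<le> 2 - 2 * (1 / w)"
    using nx x0 w by (simp add: field_simps)
  also have "\<dots> \<le> w\<^sup>2 - 1"
  proof -
    \<comment> \<open>Multiplied by \<open>w\<close>, the inequality
      \<open>2 - 2 / w \<le> w^2 - 1\<close> becomes the nonnegativity of this polynomial.\<close>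
    have "0 \<le> (w - 1)\<^sup>2 * (w + 2)"
      using w by simp
    also have "\<dots> = w * (w\<^sup>2 - 1) - (2 * w - 2)"
      by (simp add: power2_eq_square algebra_simps)
    finally show ?thesis
      using w by (simp add: field_simps)
  qed
  finally have "norm (a - x /\<^sub>R norm x) \<le> r"
    using r w by (auto intro: power2_le_imp_le)
  then show "x \<in> radial_cone (cball a r)"
    using x0 n1 by (simp add: radial_cone_def dist_norm)
qed

text \<open>The flat cone inside has height \<open>h = 1 / sqrt (1 + r^2)\<close>, and its volume is
  multiplied by the \<open>n\<close>-th power of \<open>h\<close>. The factor \<open>1 + r^2\<close>
  to the power \<open>n\<close> more than compensates for this and still tends to 1 with
  \<open>r\<close>.\<close>

lemma radial_cone_cball_ge:
  fixes a :: "real ^ 'n"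
  assumes a: "norm a = 1" and r: "0 < r"
  shows "ennreal (unit_ball_vol (real (CARD('n) - 1)) * r ^ (CARD('n) - 1)) \<le>
    ennreal ((1 + r\<^sup>2) ^ CARD('n)) * (of_nat CARD('n) * emeasure lborel (radial_cone (cball a r)))"
proof -
  define V where "V = unit_ball_vol (real (CARD('n) - 1)) * r ^ (CARD('n) - 1)"
  have V: "0 \<le> V"
    using r by (simp add: V_def)
  define h where "h = 1 / sqrt (1 + r\<^sup>2)"
  define N where "N = CARD('n)"
  have N: "N > 0"
    by (simp add: N_def)
  have h: "0 < h"
    by (simp add: h_def add_pos_nonneg)
  have "sqrt (1 + r\<^sup>2) * 1 \<le> sqrt (1 + r\<^sup>2) * sqrt (1 + r\<^sup>2)"
    by (intro mult_left_mono) auto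
  then have "1 \<le> (1 + r\<^sup>2) * h"
    by (simp add: h_def field_simps add_pos_nonneg)
  then have "1 \<le> ((1 + r\<^sup>2) * h) ^ N"
    by (rule one_le_power)
  then have 1: "V * 1 \<le> V * ((1 + r\<^sup>2) ^ N * h ^ N)"
    using V by (intro mult_left_mono) (auto simp: power_mult_distrib)
  have "ennreal V \<le> ennreal ((1 + r\<^sup>2) ^ N * (real N * (V * h ^ N / real N)))"
    using 1 N by (intro ennreal_leI) (simp add: mult_ac)
  also have "\<dots> = ennreal ((1 + r\<^sup>2) ^ N) * (of_nat N * ennreal (V * h ^ N / real N))"
    using V h by (simp add: ennreal_of_nat_eq_real_of_nat flip: ennreal_mult)
  also have "ennreal (V * h ^ N / real N) = emeasure lborel (flat_cone a r h)"
    using emeasure_flat_cone[OF a r, of h] h by (simp add: V_def N_def)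
  also have "\<dots> \<le> emeasure lborel (radial_cone (cball a r))"
    using flat_cone_subset_radial_cone[OF a r] by (intro emeasure_mono) (auto simp: h_def)
  finally show ?thesis
    by (simp add: V_def N_def mult_left_mono)
qed

text \<open>The factor by which central projection to a tangent hyperplane can enlarge a diameter
  bound of at most \<open>\<delta>\<close>. The denominator bounds two inner products with
  \<open>a\<close> from below; the whole tends to 1 as \<open>\<delta>\<close> tends to 0.\<close>

definition distortion :: "real \<Rightarrow> real" where
  "distortion \<delta> = (1 + \<delta>) / (1 - \<delta>\<^sup>2 / 2)\<^sup>2"

text \<open>
  For \<open>u, v\<close> in a set of small diameter on the sphere, \<open>u / (u \<bullet> a) - v / (v \<bullet> a)\<close> is the
  difference of their central projections to the tangent hyperplane at \<open>a\<close>.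
\<close>

lemma narrow_radial_cone:
  fixes U :: "'a::euclidean_space set"
  assumes U: "U \<subseteq> sphere 0 1" and a: "a \<in> U" and d: "\<And>u v. u \<in> U \<Longrightarrow> v \<in> U \<Longrightarrow> dist u v \<le> d"
    and \<delta>: "d \<le> \<delta>" "\<delta> < 1"
  shows "narrow a (distortion \<delta> * d) 1 (radial_cone U)"
proof -
  have d0: "0 \<le> d"
    using d[OF a a] by simp
  define q where "q = 1 - \<delta>\<^sup>2 / 2"
  have dd: "d\<^sup>2 \<le> \<delta>\<^sup>2"
    using d0 \<delta> by (intro power_mono) auto
  have "\<delta>\<^sup>2 < 1"
    using d0 \<delta> by (simp add: power_less_one_iff abs_square_less_1)
  then have q: "0 < q"
    by (simp add: q_def)
  have n1: "norm u = 1" if "u \<in> U" for u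
    using U that by auto
  have ua: "q \<le> u \<bullet> a" "1 - d\<^sup>2 / 2 \<le> u \<bullet> a" "u \<bullet> a \<le> 1" if u: "u \<in> U" for u
  proof -
    have "(dist u a)\<^sup>2 = 2 - 2 * (u \<bullet> a)"
      using n1[OF u] n1[OF a] unfolding dist_norm power2_norm_eq_inner norm_eq_1
      by (simp add: inner_diff inner_commute)
    moreover have "(dist u a)\<^sup>2 \<le> d\<^sup>2"
      using d[OF u a] by (intro power_mono) auto
    ultimately show "1 - d\<^sup>2 / 2 \<le> u \<bullet> a"
      by simp
    then show "q \<le> u \<bullet> a"
      using dd by (simp add: q_def)
    show "u \<bullet> a \<le> 1"
      using norm_cauchy_schwarz[of u a] n1[OF u] n1[OF a] by simp
  qed
  have key: "norm (u /\<^sub>R (u \<bullet> a) - v /\<^sub>R (v \<bullet> a)) \<le> distortion \<delta> * d"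
    if u: "u \<in> U" and v: "v \<in> U" for u v
  proof -
    have pos: "0 < u \<bullet> a" "0 < v \<bullet> a"
      using ua[OF u] ua[OF v] q by linarith+
    have "u /\<^sub>R (u \<bullet> a) - v /\<^sub>R (v \<bullet> a) = ((v \<bullet> a) *\<^sub>R u - (u \<bullet> a) *\<^sub>R v) /\<^sub>R ((u \<bullet> a) * (v \<bullet> a))"
      using pos by (simp add: scaleR_diff_right field_simps)
    then have "norm (u /\<^sub>R (u \<bullet> a) - v /\<^sub>R (v \<bullet> a)) =
        norm ((v \<bullet> a) *\<^sub>R u - (u \<bullet> a) *\<^sub>R v) / ((u \<bullet> a) * (v \<bullet> a))"
      using pos by (simp add: divide_inverse mult.commute abs_mult)
    also have "\<dots> \<le> ((1 + \<delta>) * d) / (q * q)"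
    proof (intro frac_le mult_mono)
      \<comment> \<open>The inner products with \<open>a\<close> lie between
        \<open>1 - d^2 / 2\<close> and 1, so the second summand costs only \<open>d^2 / 2\<close>,
        which is of higher order than \<open>d\<close>.\<close>
      have "(v \<bullet> a) *\<^sub>R u - (u \<bullet> a) *\<^sub>R v = (v \<bullet> a) *\<^sub>R (u - v) + (v \<bullet> a - u \<bullet> a) *\<^sub>R v"
        by (simp add: algebra_simps)
      then have "norm ((v \<bullet> a) *\<^sub>R u - (u \<bullet> a) *\<^sub>R v) \<le> \<bar>v \<bullet> a\<bar> * norm (u - v) + \<bar>v \<bullet> a - u \<bullet> a\<bar> * norm v"
        by (metis norm_scaleR norm_triangle_ineq)
      also have "\<dots> \<le> 1 * d + (d\<^sup>2 / 2) * 1"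
      proof (intro add_mono mult_mono)
        show "\<bar>v \<bullet> a - u \<bullet> a\<bar> \<le> d\<^sup>2 / 2"
          using ua[OF u] ua[OF v] by linarith
      qed (use pos ua[OF v] d[OF u v] n1[OF v] in \<open>auto simp: dist_norm\<close>)
      also have "\<dots> \<le> (1 + \<delta>) * d"
      proof -
        have "d * d \<le> \<delta> * d"
          using \<delta> d0 by (intro mult_right_mono) auto
        moreover have "0 \<le> d * d"
          by simp
        ultimately show ?thesis
          unfolding power2_eq_square distrib_right by linarith
      qed
      finally show "norm ((v \<bullet> a) *\<^sub>R u - (u \<bullet> a) *\<^sub>R v) \<le> (1 + \<delta>) * d" .
    qed (use q ua[OF u] ua[OF v] d0 \<delta> in auto)
    also have "\<dots> = distortion \<delta> * d"
      by (simp add: distortion_def q_def power2_eq_square)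
    finally show ?thesis .
  qed
  show ?thesis
    unfolding narrow_def
  proof (intro conjI ballI impI)
    fix x assume "x \<in> radial_cone U"
    then have x: "x \<noteq> 0" "norm x \<le> 1" "x /\<^sub>R norm x \<in> U"
      by (auto simp: radial_cone_def)
    have "x \<bullet> a = norm x * ((x /\<^sub>R norm x) \<bullet> a)"
      using x by simp
    then show "0 < x \<bullet> a"
      using ua(1)[OF x(3)] q x by (simp only: zero_less_mult_iff) auto
    show "x \<bullet> a \<le> 1"
      using norm_cauchy_schwarz[of x a] n1[OF a] x by simp
  next
    fix x y assume "x \<in> radial_cone U" "y \<in> radial_cone U" and xy: "x \<bullet> a = y \<bullet> a"
    then have x: "x \<noteq> 0" "x /\<^sub>R norm x \<in> U" and y: "y \<noteq> 0" "y /\<^sub>R norm y \<in> U"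
      by (auto simp: radial_cone_def)
    define u where "u = x /\<^sub>R norm x"
    define v where "v = y /\<^sub>R norm y"
    have uv: "u \<in> U" "v \<in> U" "x = norm x *\<^sub>R u" "y = norm y *\<^sub>R v"
      using x y by (auto simp: u_def v_def)
    have pos: "0 < u \<bullet> a" "0 < v \<bullet> a"
      using ua[OF uv(1)] ua[OF uv(2)] q by linarith+
    have "x \<bullet> a = norm x * (u \<bullet> a)" "x \<bullet> a = norm y * (v \<bullet> a)"
      using xy uv(3,4) by (metis inner_scaleR_left)+
    then have norms: "norm x = (x \<bullet> a) * inverse (u \<bullet> a)" "norm y = (x \<bullet> a) * inverse (v \<bullet> a)"
      using pos by (simp_all add: field_simps)
    have z: "0 < x \<bullet> a"
      using \<open>x \<bullet> a = norm x * (u \<bullet> a)\<close> pos x by simp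
    \<comment> \<open>Points at equal height are the same multiple of the central projections of
      their directions, so \<open>key\<close> scales to the slice.\<close>
    have "x = (x \<bullet> a) *\<^sub>R (u /\<^sub>R (u \<bullet> a))" "y = (x \<bullet> a) *\<^sub>R (v /\<^sub>R (v \<bullet> a))"
      unfolding scaleR_scaleR norms[symmetric] by (fact uv)+
    then have "x - y = (x \<bullet> a) *\<^sub>R (u /\<^sub>R (u \<bullet> a) - v /\<^sub>R (v \<bullet> a))"
      by (metis scaleR_diff_right)
    then have "norm (x - y) = (x \<bullet> a) * norm (u /\<^sub>R (u \<bullet> a) - v /\<^sub>R (v \<bullet> a))"
      using z by simp
    also have "\<dots> \<le> (x \<bullet> a) * (distortion \<delta> * d)"
      using key[OF uv(1,2)] z by (intro mult_left_mono) auto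
    finally show "norm (x - y) \<le> distortion \<delta> * d * (x \<bullet> a)"
      by (simp add: mult_ac)
  qed
qed

text \<open>The cone is narrow of height 1 with constant \<open>distortion \<delta> * d\<close>, so
  the isodiametric bound applies. The dimension in front cancels the denominator of the cone
  volume.\<close>

lemma radial_cone_le:
  fixes U :: "(real ^ 'n) set"
  assumes U: "U \<subseteq> sphere 0 1" "closed U" "U \<noteq> {}" and d: "diameter U \<le> d" and \<delta>: "d \<le> \<delta>" "\<delta> < 1"
  shows "of_nat CARD('n) * emeasure lborel (radial_cone U) \<le>
    ennreal (distortion \<delta> ^ (CARD('n) - 1)) *
      ennreal (unit_ball_vol (real (CARD('n) - 1)) * (d / 2) ^ (CARD('n) - 1))"
proof -
  define m where "m = CARD('n) - 1"
  obtain a where a: "a \<in> U"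
    using U by blast
  have bU: "bounded U"
    using U(1) bounded_subset bounded_sphere by blast
  have dist: "dist u v \<le> d" if "u \<in> U" "v \<in> U" for u v
    using diameter_bounded_bound[OF bU that] d by simp
  have d0: "0 \<le> d"
    using dist[OF a a] by simp
  have g: "0 \<le> distortion \<delta>"
    using d0 \<delta> by (simp add: distortion_def)
  have "emeasure lborel (radial_cone U) \<le>
      ennreal (unit_ball_vol (real m) * (distortion \<delta> * d / 2) ^ m * 1 ^ CARD('n) / real CARD('n))"
    unfolding m_def
  proof (rule emeasure_narrow_le[of a])
    show "norm a = 1"
      using a U by auto
    show "radial_cone U \<in> sets borel"
      using U(2) by measurable
    show "narrow a (distortion \<delta> * d) 1 (radial_cone U)"
      by (rule narrow_radial_cone[OF U(1) a dist \<delta>])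
  qed (use g d0 in auto)
  then have "of_nat CARD('n) * emeasure lborel (radial_cone U) \<le>
      ennreal (real CARD('n)) * ennreal (unit_ball_vol (real m) * (distortion \<delta> * d / 2) ^ m / real CARD('n))"
    by (simp add: ennreal_of_nat_eq_real_of_nat mult_left_mono)
  also have "\<dots> = ennreal (real CARD('n) * (unit_ball_vol (real m) * (distortion \<delta> * d / 2) ^ m / real CARD('n)))"
    using g d0 by (intro ennreal_mult[symmetric]) auto
  also have "\<dots> = ennreal (distortion \<delta> ^ m * (unit_ball_vol (real m) * (d / 2) ^ m))"
    by (simp add: power_mult_distrib power_divide mult_ac)
  also have "\<dots> = ennreal (distortion \<delta> ^ m) * ennreal (unit_ball_vol (real m) * (d / 2) ^ m)"
    using g d0 by (intro ennreal_mult) auto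
  finally show ?thesis
    by (simp add: m_def)
qed

section \<open>Lower bound for the Hausdorff content of the sphere\<close>

text \<open>For any admissible cover of the sphere, the cones over its members cover the punctured
  unit ball; their volumes are bounded by \<open>radial_cone_le\<close> and summed.\<close>

lemma hausdorff_content_sphere_ge:
  assumes \<delta>: "0 < \<delta>" "\<delta> < 1"
  shows "ennreal (real CARD('n) * unit_ball_vol (real CARD('n))) \<le>
    ennreal (distortion \<delta> ^ (CARD('n) - 1)) *
      hausdorff_content \<delta> (CARD('n) - 1) (sphere (0 :: real ^ 'n) 1)" (is "?A \<le> ?g * _")
proof -
  define m where "m = CARD('n) - 1"
  have g: "0 < distortion \<delta>"
  proof -
    have "\<delta>\<^sup>2 < 1"
      using \<delta> by (simp add: power_less_one_iff abs_square_less_1)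
    then show ?thesis
      using \<delta> by (simp add: distortion_def)
  qed
  have main: "?A \<le> ?g * (\<Sum>i. if U i = {} then 0 else ennreal (unit_ball_vol (real m) * (diameter (U i) / 2) ^ m))"
    if cover: "sphere (0 :: real ^ 'n) 1 \<subseteq> (\<Union>i. U i)"
      and U: "\<And>i. bounded (U i) \<and> diameter (U i) \<le> \<delta>" for U :: "nat \<Rightarrow> (real ^ 'n) set"
  proof -
    \<comment> \<open>Closing the sets makes the cones Borel without changing diameters, and
      \<open>radial_cone_le\<close> works with subsets of the sphere.\<close>
    define W where "W = (\<lambda>i. closure (U i) \<inter> sphere 0 1)"
    have [measurable]: "W i \<in> sets borel" for i
      by (simp add: W_def closed_Int)
    have "?A = of_nat CARD('n) * emeasure lborel (cball (0 :: real ^ 'n) 1)"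
      by (simp add: emeasure_cball ennreal_mult ennreal_of_nat_eq_real_of_nat)
    also have "emeasure lborel (cball (0 :: real ^ 'n) 1) = emeasure lborel (cball (0 :: real ^ 'n) 1 - {0})"
      by (intro emeasure_Diff_null_set[symmetric]) auto
    also have "\<dots> \<le> emeasure lborel (\<Union>i. radial_cone (W i))"
    proof (intro emeasure_mono subsetI)
      fix x :: "real ^ 'n" assume x: "x \<in> cball 0 1 - {0}"
      then have "x /\<^sub>R norm x \<in> sphere 0 1"
        by simp
      moreover from this obtain i where "x /\<^sub>R norm x \<in> U i"
        using cover by blast
      ultimately have "x /\<^sub>R norm x \<in> W i"
        using closure_subset by (auto simp: W_def)
      then show "x \<in> (\<Union>i. radial_cone (W i))"
        using x by (auto simp: radial_cone_def)
    qed auto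
    also have "\<dots> \<le> (\<Sum>i. emeasure lborel (radial_cone (W i)))"
      by (intro emeasure_subadditive_countably) auto
    finally have "?A \<le> (\<Sum>i. of_nat CARD('n) * emeasure lborel (radial_cone (W i)))"
      by (simp add: mult_left_mono)
    also have "\<dots> \<le> (\<Sum>i. ?g * (if U i = {} then 0 else
        ennreal (unit_ball_vol (real m) * (diameter (U i) / 2) ^ m)))"
    proof (intro suminf_le)
      fix i
      show "of_nat CARD('n) * emeasure lborel (radial_cone (W i)) \<le> ?g * (if U i = {} then 0 else
        ennreal (unit_ball_vol (real m) * (diameter (U i) / 2) ^ m))"
      proof (cases "W i = {}")
        case True
        then show ?thesis
          by (simp add: radial_cone_def)
      next
        case False
        then have "U i \<noteq> {}"
          by (auto simp: W_def)
        have "diameter (W i) \<le> diameter (closure (U i))"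
          using U by (intro diameter_subset) (auto simp: W_def)
        also have "\<dots> = diameter (U i)"
          using U by (simp add: diameter_closure)
        finally have "of_nat CARD('n) * emeasure lborel (radial_cone (W i)) \<le>
            ?g * ennreal (unit_ball_vol (real m) * (diameter (U i) / 2) ^ m)"
          unfolding m_def using False U \<delta>
          by (intro radial_cone_le) (auto simp: W_def)
        then show ?thesis
          using \<open>U i \<noteq> {}\<close> by simp
      qed
    qed auto
    finally show ?thesis
      by simp
  qed
  \<comment> \<open>The factor goes to the left as a division, so that the bound for each cover
    passes directly to the infimum.\<close>
  have "?A / ?g \<le> hausdorff_content \<delta> m (sphere (0 :: real ^ 'n) 1)"
    unfolding hausdorff_content_def
  proof (intro INF_greatest)
    fix U :: "nat \<Rightarrow> (real ^ 'n) set"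
    assume "U \<in> {U. sphere 0 1 \<subseteq> (\<Union>i. U i) \<and> (\<forall>i. bounded (U i) \<and> diameter (U i) \<le> \<delta>)}"
    then have "?A \<le> ?g * (\<Sum>i. if U i = {} then 0 else ennreal (unit_ball_vol (real m) * (diameter (U i) / 2) ^ m))"
      by (intro main) auto
    then show "?A / ?g \<le> (\<Sum>i. if U i = {} then 0 else ennreal (unit_ball_vol (real m) * (diameter (U i) / 2) ^ m))"
      using g by (intro divide_le_posI_ennreal) (auto simp: mult.commute)
  qed
  then have "?g * (?A / ?g) \<le> ?g * hausdorff_content \<delta> m (sphere (0 :: real ^ 'n) 1)"
    by (intro mult_left_mono) auto
  moreover have "?g * (?A / ?g) = ?A"
    using g by (simp add: ennreal_times_divide ennreal_mult_divide_eq mult.commute)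
  ultimately show ?thesis
    by (simp add: m_def)
qed

section \<open>Upper bound for the Hausdorff content by a Vitali covering\<close>

text \<open>Disjoint balls of radius at most \<open>\<rho>\<close> cut out disjoint cones in the
  unit ball, so the total of their contributions is controlled by its volume. To obtain a cover,
  only the balls from index \<open>M\<close> on are enlarged five times; the cost is a multiple of
  the tail of a convergent series. Enlarged balls have diameter at most \<open>10 * \<rho>\<close>,
  hence the condition on \<open>\<rho>\<close>.\<close>

lemma hausdorff_content_sphere_le_scale:
  assumes \<delta>: "0 < \<delta>" and \<rho>: "0 < \<rho>" "10 * \<rho> \<le> \<delta>"
  shows "hausdorff_content \<delta> (CARD('n) - 1) (sphere (0 :: real ^ 'n) 1) \<le>
    ennreal ((1 + \<rho>\<^sup>2) ^ CARD('n)) * ennreal (real CARD('n) * unit_ball_vol (real CARD('n)))"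
proof -
  define m where "m = CARD('n) - 1"
  define S where "S = sphere (0 :: real ^ 'n) 1"
  define F where "F = ennreal ((1 + \<rho>\<^sup>2) ^ CARD('n))"
  define K where "K = {p :: (real ^ 'n) \<times> real. norm (fst p) = 1 \<and> 0 < snd p \<and> snd p \<le> \<rho>}"
  have "0 < snd i \<and> snd i \<le> \<rho>" if "i \<in> K" for i
    using that by (simp add: K_def)
  then obtain C where C: "countable C" "C \<subseteq> K"
    "pairwise (\<lambda>i j. disjnt (cball (fst i) (snd i)) (cball (fst j) (snd j))) C"
    "\<And>i. i \<in> K \<Longrightarrow> \<exists>j. j \<in> C \<and> \<not> disjnt (cball (fst i) (snd i)) (cball (fst j) (snd j)) \<and>
      cball (fst i) (snd i) \<subseteq> ball (fst j) (5 * snd j)"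
    by (rule Vitali_covering_lemma_cballs_balls[where K = K and a = fst]) blast+
  define f where "f = to_nat_on C"
  define p where "p = from_nat_into C"
  have pf: "p (f i) = i" if "i \<in> C" for i
    using that C(1) by (simp add: p_def f_def)
  have fp: "p n \<in> C" "f (p n) = n" if "n \<in> f ` C" for n
    using that pf by auto
  have pK: "norm (fst (p n)) = 1" "0 < snd (p n)" "snd (p n) \<le> \<rho>" if "n \<in> f ` C" for n
    using fp(1)[OF that] C(2) by (auto simp: K_def)
  define V where "V = (\<lambda>n. if n \<in> f ` C then cball (fst (p n)) (snd (p n)) else {})"
  have disjV: "disjoint_family V"
    unfolding disjoint_family_on_def V_def
  proof (intro ballI impI)
    fix i j :: nat assume "i \<noteq> j"
    then have "disjnt (cball (fst (p i)) (snd (p i))) (cball (fst (p j)) (snd (p j)))"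
      if "i \<in> f ` C" "j \<in> f ` C"
      using C(3) fp[OF that(1)] fp[OF that(2)] unfolding pairwise_def by metis
    then show "(if i \<in> f ` C then cball (fst (p i)) (snd (p i)) else {}) \<inter>
        (if j \<in> f ` C then cball (fst (p j)) (snd (p j)) else {}) = {}"
      by (auto simp: disjnt_def)
  qed
  define Q where "Q = (\<lambda>n. F * (of_nat CARD('n) * emeasure lborel (radial_cone (V n))))"
  have [measurable]: "V n \<in> sets borel" for n
    by (simp add: V_def)
  have "(\<Sum>n. emeasure lborel (radial_cone (V n))) = emeasure lborel (\<Union>n. radial_cone (V n))"
    using disjV by (intro suminf_emeasure) (auto simp: disjoint_family_on_def radial_cone_def)
  also have "\<dots> \<le> emeasure lborel (cball (0 :: real ^ 'n) 1)"
    by (intro emeasure_mono) (auto simp: radial_cone_def)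
  also have "\<dots> = ennreal (unit_ball_vol (real CARD('n)))"
    by (simp add: emeasure_cball)
  finally have "F * (of_nat CARD('n) * (\<Sum>n. emeasure lborel (radial_cone (V n)))) \<le>
      F * (of_nat CARD('n) * ennreal (unit_ball_vol (real CARD('n))))"
    by (intro mult_left_mono) auto
  then have sumQ: "(\<Sum>n. Q n) \<le> F * ennreal (real CARD('n) * unit_ball_vol (real CARD('n)))"
    by (simp add: Q_def ennreal_mult ennreal_of_nat_eq_real_of_nat)
  have ballQ: "ennreal (unit_ball_vol (real m) * snd (p n) ^ m) \<le> Q n" if n: "n \<in> f ` C" for n
  proof -
    have "ennreal (unit_ball_vol (real m) * snd (p n) ^ m) \<le>
        ennreal ((1 + (snd (p n))\<^sup>2) ^ CARD('n)) * (of_nat CARD('n) * emeasure lborel (radial_cone (V n)))"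
      using radial_cone_cball_ge[OF pK(1,2)[OF n]] n by (simp add: V_def m_def)
    also have "\<dots> \<le> Q n"
      unfolding Q_def F_def using pK[OF n]
      by (intro mult_right_mono ennreal_leI power_mono add_left_mono) auto
    finally show ?thesis .
  qed
  have bound: "hausdorff_content \<delta> m S \<le> (\<Sum>n. Q n + ennreal (5 ^ m) * (if n < M then 0 else Q n))" for M
  proof -
    define U where "U = (\<lambda>n. if n \<in> f ` C then cball (fst (p n)) ((if n < M then 1 else 5) * snd (p n)) else {})"
    have "S \<subseteq> (\<Union>n. U n)"
    proof
      fix x assume x: "x \<in> S"
      define T where "T = (\<Union>n\<in>{n. n \<in> f ` C \<and> n < M}. cball (fst (p n)) (snd (p n)))"
      show "x \<in> (\<Union>n. U n)"
      proof (cases "x \<in> T")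
        case True
        then show ?thesis
          by (auto simp: T_def U_def)
      next
        case False
        have "closed T"
          unfolding T_def by (intro closed_UN) auto
        with False obtain e where e: "0 < e" "ball x e \<subseteq> - T"
          using open_contains_ball[of "- T"] by (auto simp: open_Compl)
        \<comment> \<open>The ball of radius \<open>r\<close> about \<open>x\<close> misses the
          first \<open>M\<close> balls. The selected ball that it meets therefore has index at least
          \<open>M\<close>, and its enlargement contains \<open>x\<close>.\<close>
        define r where "r = min \<rho> (e / 2)"
        have "(x, r) \<in> K"
          using x e \<rho> by (simp add: K_def r_def S_def)
        then obtain j where j: "j \<in> C" "\<not> disjnt (cball x r) (cball (fst j) (snd j))"
            "cball x r \<subseteq> ball (fst j) (5 * snd j)"
          using C(4) by fastforce
        have "\<not> f j < M"
        proof
          assume "f j < M"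
          then have "cball (fst j) (snd j) \<subseteq> T"
            using j(1) pf[OF j(1)] by (force simp: T_def)
          moreover have "cball x r \<subseteq> ball x e"
            using e by (auto simp: r_def)
          ultimately show False
            using j(2) e(2) by (auto simp: disjnt_def)
        qed
        then have "U (f j) = cball (fst j) (5 * snd j)"
          using j(1) by (simp add: U_def pf)
        moreover have "x \<in> cball x r"
          using e \<rho> by (simp add: r_def)
        ultimately have "x \<in> U (f j)"
          using j(3) ball_subset_cball by blast
        then show ?thesis
          by blast
      qed
    qed
    moreover have "bounded (U n) \<and> diameter (U n) \<le> \<delta>" for n
      using pK[of n] \<rho> \<delta> by (auto simp: U_def)
    ultimately have "hausdorff_content \<delta> m S \<le>
        (\<Sum>n. if U n = {} then 0 else ennreal (unit_ball_vol (real m) * (diameter (U n) / 2) ^ m))"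
      unfolding hausdorff_content_def by (intro INF_lower) auto
    also have "\<dots> \<le> (\<Sum>n. Q n + ennreal (5 ^ m) * (if n < M then 0 else Q n))"
    proof (intro suminf_le)
      fix n
      show "(if U n = {} then 0 else ennreal (unit_ball_vol (real m) * (diameter (U n) / 2) ^ m))
          \<le> Q n + ennreal (5 ^ m) * (if n < M then 0 else Q n)"
      proof (cases "n \<in> f ` C")
        case n: True
        show ?thesis
        proof (cases "n < M")
          case True
          then show ?thesis
            using ballQ[OF n] n pK[OF n] by (simp add: U_def)
        next
          case False
          have "ennreal (unit_ball_vol (real m) * (5 * snd (p n)) ^ m) =
              ennreal (5 ^ m) * ennreal (unit_ball_vol (real m) * snd (p n) ^ m)"
            using pK[OF n] by (simp add: power_mult_distrib mult_ac flip: ennreal_mult)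
          also have "\<dots> \<le> ennreal (5 ^ m) * Q n"
            using ballQ[OF n] by (intro mult_left_mono) auto
          also have "\<dots> \<le> Q n + ennreal (5 ^ m) * Q n"
            by simp
          finally show ?thesis
            using False n pK[OF n] by (simp add: U_def)
        qed
      qed (simp add: U_def)
    qed auto
    finally show ?thesis .
  qed
  have fin: "(\<Sum>n. Q n) < top"
    using sumQ by (rule le_less_trans) (simp add: F_def flip: ennreal_mult)
  then have Qfin: "Q n < top" for n
    by (rule ennreal_suminf_lessD)
  define q where "q = (\<lambda>n. enn2real (Q n))"
  have Qq: "Q n = ennreal (q n)" for n
    using Qfin[of n] by (simp add: q_def)
  have q0: "0 \<le> q n" for n
    by (simp add: q_def)
  have sq: "summable q"
    using fin by (intro summable_suminf_not_top) (auto simp: q0 Qq)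
  have "hausdorff_content \<delta> m S \<le> (\<Sum>n. Q n)"
  proof (rule ennreal_le_epsilon)
    fix \<epsilon> :: real assume \<epsilon>: "0 < \<epsilon>"
    \<comment> \<open>The tail from \<open>M\<close> on is so small that even after the factor
      \<open>5 ^ m\<close> at most \<open>\<epsilon>\<close> is added.\<close>
    then obtain M where M: "norm (\<Sum>i. q (i + M)) < \<epsilon> / 5 ^ m"
      using suminf_exist_split[OF _ sq, of "\<epsilon> / 5 ^ m"] by auto
    have "(\<Sum>n. if n < M then 0 else Q n) =
        (\<Sum>n. (if n + M < M then 0 else Q (n + M))) + (\<Sum>n<M. if n < M then 0 else Q n)"
      by (intro suminf_offset) auto
    also have "\<dots> = (\<Sum>n. ennreal (q (n + M)))"
      by (simp add: Qq)
    also have "\<dots> = ennreal (\<Sum>n. q (n + M))"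
      using q0 sq by (intro suminf_ennreal2) (auto simp: summable_iff_shift)
    also have "\<dots> \<le> ennreal (\<epsilon> / 5 ^ m)"
      using M by (intro ennreal_leI) auto
    finally have "ennreal (5 ^ m) * (\<Sum>n. if n < M then 0 else Q n) \<le> ennreal (5 ^ m) * ennreal (\<epsilon> / 5 ^ m)"
      by (intro mult_left_mono) auto
    also have "\<dots> = ennreal \<epsilon>"
      using \<epsilon> by (simp flip: ennreal_mult)
    finally have tail: "ennreal (5 ^ m) * (\<Sum>n. if n < M then 0 else Q n) \<le> ennreal \<epsilon>" .
    have "hausdorff_content \<delta> m S \<le> (\<Sum>n. Q n) + (\<Sum>n. ennreal (5 ^ m) * (if n < M then 0 else Q n))"
      using bound[of M] by (simp add: suminf_add[symmetric])
    also have "\<dots> \<le> (\<Sum>n. Q n) + ennreal \<epsilon>"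
      using tail by (intro add_left_mono) simp
    finally show "hausdorff_content \<delta> m S \<le> (\<Sum>n. Q n) + ennreal \<epsilon>" .
  qed
  with sumQ show ?thesis
    unfolding m_def S_def F_def by (rule order_trans[rotated])
qed

text \<open>The content does not depend on \<open>\<rho>\<close>, so the factor in front of the
  volume can be sent to 1.\<close>

lemma hausdorff_content_sphere_le:
  assumes \<delta>: "0 < \<delta>"
  shows "hausdorff_content \<delta> (CARD('n) - 1) (sphere (0 :: real ^ 'n) 1) \<le>
    ennreal (real CARD('n) * unit_ball_vol (real CARD('n)))" (is "?H \<le> ?A")
proof (rule tendsto_lowerbound)
  have "((\<lambda>\<rho>. ennreal ((1 + \<rho>\<^sup>2) ^ CARD('n)) * ?A) \<longlongrightarrow> ennreal ((1 + 0\<^sup>2) ^ CARD('n)) * ?A) (at_right 0)"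
    unfolding mult.commute[of _ ?A] by (intro ennreal_tendsto_cmult tendsto_intros) auto
  then show "((\<lambda>\<rho>. ennreal ((1 + \<rho>\<^sup>2) ^ CARD('n)) * ?A) \<longlongrightarrow> ?A) (at_right 0)"
    by simp
  have "eventually (\<lambda>\<rho>. \<rho> \<in> {0<..<\<delta> / 10}) (at_right 0)"
    using \<delta> by (intro eventually_at_right_real) auto
  then show "eventually (\<lambda>\<rho>. ?H \<le> ennreal ((1 + \<rho>\<^sup>2) ^ CARD('n)) * ?A) (at_right 0)"
  proof eventually_elim
    case (elim \<rho>)
    then show ?case
      using \<delta> by (intro hausdorff_content_sphere_le_scale) auto
  qed
qed auto

text \<open>Both content estimates become sharp in the limit. For dimension 1 the value is 2, the
  number of points of the sphere.\<close>

theorem hausdorff_measure_sphere: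
  "hausdorff_measure (CARD('n) - 1) (sphere (0 :: real ^ 'n) 1) =
    ennreal (real CARD('n) * unit_ball_vol (real CARD('n)))" (is "?H = ?A")
proof (rule antisym)
  show "?H \<le> ?A"
    unfolding hausdorff_measure_def by (intro SUP_least hausdorff_content_sphere_le) auto
  show "?A \<le> ?H"
  proof (rule tendsto_lowerbound)
    \<comment> \<open>Finiteness, known from the upper bound, is what makes multiplication by
      \<open>?H\<close> continuous in the limit that follows.\<close>
    have H: "?H < top"
      using \<open>?H \<le> ?A\<close> by (rule le_less_trans) simp
    have "((\<lambda>\<delta>. ennreal (distortion \<delta> ^ (CARD('n) - 1)) * ?H) \<longlongrightarrow>
        ennreal (((1 + 0) / (1 - 0\<^sup>2 / 2)\<^sup>2) ^ (CARD('n) - 1)) * ?H) (at_right 0)"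
      unfolding mult.commute[of _ ?H] distortion_def
      using H by (intro ennreal_tendsto_cmult tendsto_intros) auto
    then show "((\<lambda>\<delta>. ennreal (distortion \<delta> ^ (CARD('n) - 1)) * ?H) \<longlongrightarrow> ?H) (at_right 0)"
      by simp
    have "eventually (\<lambda>\<delta>. \<delta> \<in> {0<..<1}) (at_right (0 :: real))"
      by (intro eventually_at_right_real) auto
    then show "eventually (\<lambda>\<delta>. ?A \<le> ennreal (distortion \<delta> ^ (CARD('n) - 1)) * ?H) (at_right 0)"
    proof eventually_elim
      case (elim \<delta>)
      then have "?A \<le> ennreal (distortion \<delta> ^ (CARD('n) - 1)) *
          hausdorff_content \<delta> (CARD('n) - 1) (sphere (0 :: real ^ 'n) 1)"
        by (intro hausdorff_content_sphere_ge) auto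
      also have "\<dots> \<le> ennreal (distortion \<delta> ^ (CARD('n) - 1)) * ?H"
        using elim unfolding hausdorff_measure_def by (intro mult_left_mono SUP_upper) auto
      finally show ?case .
    qed
  qed auto
qed

section \<open>Asymptotics of the fractional perimeter\<close>

definition riesz_kernel :: "real \<Rightarrow> 'a::euclidean_space \<Rightarrow> ennreal" where
  "riesz_kernel s z = ennreal (1 / norm z powr (real DIM('a) + s))"

lemma kernel_measurable [measurable]: "riesz_kernel s \<in> borel_measurable borel"
  unfolding riesz_kernel_def by measurable

lemma interaction_kernel:
  "interaction s A B = (\<integral>\<^sup>+x\<in>A. (\<integral>\<^sup>+y\<in>B. riesz_kernel s (x - y) \<partial>lebesgue) \<partial>lebesgue)"
  by (simp add: interaction_def riesz_kernel_def)

text \<open>Away from 0 the quotient of the kernels is \<open>norm z powr (s0 - s)\<close>, with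
  exponent between 0 and 1 and base at most \<open>\<rho>\<close>. The resulting constant
  \<open>\<rho>\<close> is independent of \<open>s\<close>.\<close>

lemma riesz_kernel_le:
  fixes z :: "'a::euclidean_space"
  assumes s: "s \<le> s0" "s0 \<le> s + 1" and z: "norm z \<le> \<rho>" and \<rho>: "1 \<le> \<rho>"
  shows "riesz_kernel s z \<le> ennreal \<rho> * riesz_kernel s0 z"
proof (cases "z = 0")
  case False
  define n where "n = norm z"
  have n: "0 < n" "n \<le> \<rho>"
    using False z by (auto simp: n_def)
  have "n powr (s0 - s) \<le> \<rho> powr (s0 - s)"
    using n s by (intro powr_mono2) auto
  also have "\<dots> \<le> \<rho> powr 1"
    using s \<rho> by (intro powr_mono) auto
  finally have le: "n powr (s0 - s) \<le> \<rho>"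
    using \<rho> by simp
  have "n powr (real DIM('a) + s0) = n powr (real DIM('a) + s) * n powr (s0 - s)"
    by (simp add: powr_add[symmetric])
  also have "\<dots> \<le> n powr (real DIM('a) + s) * \<rho>"
    using le by (intro mult_left_mono) auto
  finally have "1 / n powr (real DIM('a) + s) \<le> \<rho> * (1 / n powr (real DIM('a) + s0))"
    using n by (simp add: field_simps)
  then show ?thesis
    using \<rho> by (simp add: riesz_kernel_def n_def ennreal_leI flip: ennreal_mult)
qed (simp add: riesz_kernel_def)

lemma nn_integral_powr_tail:
  fixes p \<rho> :: real
  assumes p: "0 < p" and \<rho>: "0 < \<rho>"
  shows "(\<integral>\<^sup>+t. ennreal (p * t powr (- p - 1)) * indicator {\<rho>..} t \<partial>lborel) = ennreal (\<rho> powr (- p))"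
proof -
  have "(\<integral>\<^sup>+t. ennreal (p * t powr (- p - 1)) * indicator {\<rho>..} t \<partial>lborel) = ennreal (0 - (- (\<rho> powr (- p))))"
  proof (rule nn_integral_FTC_atLeast)
    fix t assume "\<rho> \<le> t"
    then have "0 < t"
      using \<rho> by simp
    then show "((\<lambda>t. - (t powr (- p))) has_real_derivative p * t powr (- p - 1)) (at t)"
      by (auto intro!: derivative_eq_intros)
    show "0 \<le> p * t powr (- p - 1)"
      using p by simp
  next
    have "((\<lambda>t. t powr (- p)) \<longlongrightarrow> 0) at_top"
      using p by (intro tendsto_neg_powr filterlim_ident) auto
    then show "((\<lambda>t. - (t powr (- p))) \<longlongrightarrow> 0) at_top"
      using tendsto_minus by fastforce
  qed auto
  then show ?thesis
    by simp
qed

text \<open>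
  Writing \<open>norm z powr (- p)\<close> as the integral of \<open>p * t powr (- p - 1)\<close> over \<open>t \<ge> norm z\<close> reduces
  the integral to volumes of spherical shells, so that no polar coordinates are needed.
\<close>

lemma nn_integral_kernel_tail:
  fixes \<rho> s :: real
  assumes s: "0 < s" and \<rho>: "0 < \<rho>"
  shows "(\<integral>\<^sup>+z. riesz_kernel s (z :: 'a::euclidean_space) * indicator {z. \<rho> \<le> norm z} z \<partial>lborel) =
    ennreal (real DIM('a) * unit_ball_vol (real DIM('a)) * \<rho> powr (- s) / s)"
proof -
  define N where "N = DIM('a)"
  define v where "v = unit_ball_vol (real N)"
  have v: "0 \<le> v"
    by (simp add: v_def)
  define p where "p = real N + s"
  have p: "0 < p" "real N < p"
    using s by (auto simp: p_def N_def)
  have p_eq: "real DIM('a) + s = p"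
    by (simp add: p_def N_def)
  define f where "f = (\<lambda>t. p * t powr (- p - 1))"
  have f0: "0 \<le> f t" for t
    using p by (simp add: f_def)
  have [measurable]: "f \<in> borel_measurable borel"
    unfolding f_def by measurable
  have "(\<integral>\<^sup>+z. riesz_kernel s (z :: 'a) * indicator {z. \<rho> \<le> norm z} z \<partial>lborel) =
      (\<integral>\<^sup>+z. (\<integral>\<^sup>+t. ennreal (f t) * indicator {(z, t). \<rho> \<le> norm z \<and> norm z \<le> t} (z :: 'a, t) \<partial>lborel) \<partial>lborel)"
  proof (intro nn_integral_cong)
    fix z :: 'a
    show "riesz_kernel s z * indicator {z. \<rho> \<le> norm z} z =
        (\<integral>\<^sup>+t. ennreal (f t) * indicator {(z, t). \<rho> \<le> norm z \<and> norm z \<le> t} (z, t) \<partial>lborel)"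
    proof (cases "\<rho> \<le> norm z")
      case True
      then have "(\<integral>\<^sup>+t. ennreal (f t) * indicator {(z, t). \<rho> \<le> norm z \<and> norm z \<le> t} (z, t) \<partial>lborel)
          = (\<integral>\<^sup>+t. ennreal (p * t powr (- p - 1)) * indicator {norm z..} t \<partial>lborel)"
        by (intro nn_integral_cong) (auto simp: indicator_def f_def)
      also have "\<dots> = ennreal (norm z powr (- p))"
        using True \<rho> p by (intro nn_integral_powr_tail) auto
      also have "\<dots> = riesz_kernel s z"
        by (simp add: riesz_kernel_def p_eq powr_minus_divide)
      finally show ?thesis
        using True by simp
    qed auto
  qed
  also have "\<dots> = (\<integral>\<^sup>+t. (\<integral>\<^sup>+z. ennreal (f t) * indicator {(z, t). \<rho> \<le> norm z \<and> norm z \<le> t} (z :: 'a, t) \<partial>lborel) \<partial>lborel)"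
    by (rule lborel_pair.Fubini'[symmetric]) measurable
  also have "\<dots> = (\<integral>\<^sup>+t. ennreal (f t * (v * (t ^ N - \<rho> ^ N))) * indicator {\<rho>..} t \<partial>lborel)"
  proof (intro nn_integral_cong)
    fix t
    have "(\<integral>\<^sup>+z. ennreal (f t) * indicator {(z, t). \<rho> \<le> norm z \<and> norm z \<le> t} (z :: 'a, t) \<partial>lborel)
        = (\<integral>\<^sup>+z. ennreal (f t) * indicator (cball 0 t - ball (0 :: 'a) \<rho>) z \<partial>lborel)"
      by (intro nn_integral_cong) (auto simp: indicator_def)
    also have "\<dots> = ennreal (f t) * emeasure lborel (cball 0 t - ball (0 :: 'a) \<rho>)"
      by (simp add: nn_integral_cmult_indicator)
    also have "\<dots> = ennreal (f t * (v * (t ^ N - \<rho> ^ N))) * indicator {\<rho>..} t"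
    proof (cases "\<rho> \<le> t")
      case True
      have "emeasure lborel (cball 0 t - ball (0 :: 'a) \<rho>) =
          emeasure lborel (cball (0 :: 'a) t) - emeasure lborel (ball (0 :: 'a) \<rho>)"
        using True \<rho> by (intro emeasure_Diff) (auto simp: emeasure_ball)
      also have "\<dots> = ennreal (v * t ^ N) - ennreal (v * \<rho> ^ N)"
        using True \<rho> by (simp add: emeasure_ball emeasure_cball v_def N_def)
      also have "\<dots> = ennreal (v * (t ^ N - \<rho> ^ N))"
        using v \<rho> by (simp add: ennreal_minus right_diff_distrib)
      finally show ?thesis
        using True \<rho> v f0 by (simp add: ennreal_mult power_mono)
    next
      case False
      then have empty: "cball 0 t - ball (0 :: 'a) \<rho> = {}"
        by auto
      show ?thesis
        unfolding empty using False by simp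
    qed
    finally show "(\<integral>\<^sup>+z. ennreal (f t) * indicator {(z, t). \<rho> \<le> norm z \<and> norm z \<le> t} (z :: 'a, t) \<partial>lborel) = \<dots>" .
  qed
  \<comment> \<open>Both powers in the antiderivative decay at infinity, the slower one thanks to
    \<open>s > 0\<close>, so only the value at \<open>\<rho>\<close> remains.\<close>
  also have "\<dots> = ennreal (0 - (- v * (p / s) * \<rho> powr (- s) + v * \<rho> ^ N * \<rho> powr (- p)))"
  proof (rule nn_integral_FTC_atLeast[where F = "\<lambda>t. - v * (p / s) * t powr (- s) + v * \<rho> ^ N * t powr (- p)"])
    fix t assume t: "\<rho> \<le> t"
    then have t0: "0 < t"
      using \<rho> by simp
    have "t ^ N * t powr (- p - 1) = t powr (- s - 1)"
      using t0 by (simp add: powr_realpow[symmetric] powr_add[symmetric] p_def)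
    then have eq: "f t * (v * (t ^ N - \<rho> ^ N)) = v * p * t powr (- s - 1) - v * \<rho> ^ N * p * t powr (- p - 1)"
      by (simp add: f_def algebra_simps)
    show "((\<lambda>t. - v * (p / s) * t powr (- s) + v * \<rho> ^ N * t powr (- p)) has_real_derivative
        f t * (v * (t ^ N - \<rho> ^ N))) (at t)"
      unfolding eq using t0 s by (auto intro!: derivative_eq_intros simp: field_simps)
    show "0 \<le> f t * (v * (t ^ N - \<rho> ^ N))"
      using f0 v t \<rho> by (simp add: power_mono)
  next
    have "((\<lambda>t. - v * (p / s) * t powr (- s) + v * \<rho> ^ N * t powr (- p)) \<longlongrightarrow>
        - v * (p / s) * 0 + v * \<rho> ^ N * 0) at_top"
      using p s by (intro tendsto_intros tendsto_neg_powr filterlim_ident) auto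
    then show "((\<lambda>t. - v * (p / s) * t powr (- s) + v * \<rho> ^ N * t powr (- p)) \<longlongrightarrow> 0) at_top"
      by simp
  qed measurable
  \<comment> \<open>The coefficient of \<open>\<rho> powr (- s)\<close> is
    \<open>v * (p / s - 1)\<close>, and \<open>p - s = N\<close>.\<close>
  also have "0 - (- v * (p / s) * \<rho> powr (- s) + v * \<rho> ^ N * \<rho> powr (- p)) = real N * v * \<rho> powr (- s) / s"
  proof -
    have "\<rho> ^ N * \<rho> powr (- p) = \<rho> powr (- s)"
      using \<rho> by (simp add: powr_realpow[symmetric] powr_add[symmetric] p_def)
    then have "0 - (- v * (p / s) * \<rho> powr (- s) + v * \<rho> ^ N * \<rho> powr (- p)) =
        v * (p / s) * \<rho> powr (- s) - v * \<rho> powr (- s)"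
      by (simp add: mult.assoc)
    also have "\<dots> = real N * v * \<rho> powr (- s) / s"
      using s by (simp add: p_def field_simps)
    finally show ?thesis .
  qed
  finally show ?thesis
    by (simp add: N_def v_def)
qed

lemma nn_integral_kernel_tail_shift:
  fixes \<rho> s :: real and x :: "'a::euclidean_space"
  assumes s: "0 < s" and \<rho>: "0 < \<rho>"
  shows "(\<integral>\<^sup>+y. riesz_kernel s (x - y) * indicator {y. \<rho> \<le> norm (x - y)} y \<partial>lebesgue) =
    ennreal (real DIM('a) * unit_ball_vol (real DIM('a)) * \<rho> powr (- s) / s)"
proof -
  have "(\<integral>\<^sup>+y. riesz_kernel s (x - y) * indicator {y. \<rho> \<le> norm (x - y)} y \<partial>lebesgue) =
      (\<integral>\<^sup>+y. riesz_kernel s (x - y) * indicator {y. \<rho> \<le> norm (x - y)} y \<partial>distr lborel borel ((+) x))"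
    by (simp add: nn_integral_completion lborel_distr_plus)
  also have "\<dots> = (\<integral>\<^sup>+z. riesz_kernel s (- z) * indicator {y. \<rho> \<le> norm (x - y)} (x + z) \<partial>lborel)"
    by (subst nn_integral_distr) auto
  also have "\<dots> = (\<integral>\<^sup>+z. riesz_kernel s (z :: 'a) * indicator {z. \<rho> \<le> norm z} z \<partial>lborel)"
    by (intro nn_integral_cong) (auto simp: riesz_kernel_def indicator_def)
  finally show ?thesis
    by (simp add: nn_integral_kernel_tail[OF s \<rho>])
qed

section \<open>Comparison of interactions for different exponents\<close>

text \<open>\<open>B\<close> is only Lebesgue measurable. Replacing its indicator by an almost
  everywhere equal Borel function changes the inner integral for no \<open>x\<close> and makes Borel
  measurability of the parameter integral available.\<close>

lemma nn_integral_kernel_measurable: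
  fixes B :: "'a::euclidean_space set"
  assumes B: "B \<in> sets lebesgue"
  shows "(\<lambda>x. \<integral>\<^sup>+y\<in>B. riesz_kernel s (x - y) \<partial>lebesgue) \<in> borel_measurable lebesgue"
proof -
  have "(indicator B :: 'a \<Rightarrow> ennreal) \<in> borel_measurable lebesgue"
    using B by simp
  then obtain g :: "'a \<Rightarrow> ennreal" where g: "g \<in> borel_measurable lborel" "AE y in lborel. indicator B y = g y"
    using completion_ex_borel_measurable by blast
  then have [measurable]: "g \<in> borel_measurable borel"
    by simp
  have "(\<integral>\<^sup>+y\<in>B. riesz_kernel s (x - y) \<partial>lebesgue) = (\<integral>\<^sup>+y. riesz_kernel s (x - y) * g y \<partial>lborel)" for x
    unfolding nn_integral_completion using g(2) by (intro nn_integral_cong_AE) auto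
  moreover have "(\<lambda>x. \<integral>\<^sup>+y. riesz_kernel s (x - y) * g y \<partial>lborel) \<in> borel_measurable borel"
    by measurable
  ultimately show ?thesis
    by (simp add: measurable_completion)
qed

lemma kernel_shift_measurable:
  "(\<lambda>y :: 'a::euclidean_space. riesz_kernel s (x - y)) \<in> borel_measurable lebesgue"
  by (intro measurable_completion) simp

text \<open>Meant for the two interactions whose points all lie in the bounded set
  \<open>E \<union> \<Omega>\<close>; the pointwise kernel comparison is integrated twice.\<close>

lemma interaction_mono_exponent:
  fixes A B :: "'a::euclidean_space set"
  assumes B: "B \<in> sets lebesgue" and A: "A \<in> sets lebesgue"
    and s: "s \<le> s0" "s0 \<le> s + 1" and \<rho>: "1 \<le> \<rho>"
    and AB: "\<And>x y. x \<in> A \<Longrightarrow> y \<in> B \<Longrightarrow> norm (x - y) \<le> \<rho>"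
  shows "interaction s A B \<le> ennreal \<rho> * interaction s0 A B"
proof -
  note [measurable] = A B kernel_shift_measurable nn_integral_kernel_measurable[OF B]
  have inner: "(\<integral>\<^sup>+y\<in>B. riesz_kernel s (x - y) \<partial>lebesgue) \<le> ennreal \<rho> * (\<integral>\<^sup>+y\<in>B. riesz_kernel s0 (x - y) \<partial>lebesgue)"
    if "x \<in> A" for x
  proof -
    have "(\<integral>\<^sup>+y\<in>B. riesz_kernel s (x - y) \<partial>lebesgue) \<le> (\<integral>\<^sup>+y. ennreal \<rho> * (riesz_kernel s0 (x - y) * indicator B y) \<partial>lebesgue)"
      using riesz_kernel_le[OF s AB[OF that] \<rho>] by (intro nn_integral_mono) (auto simp: indicator_def)
    also have "\<dots> = ennreal \<rho> * (\<integral>\<^sup>+y\<in>B. riesz_kernel s0 (x - y) \<partial>lebesgue)"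
      by (intro nn_integral_cmult) measurable
    finally show ?thesis .
  qed
  have "interaction s A B \<le> (\<integral>\<^sup>+x. ennreal \<rho> * ((\<integral>\<^sup>+y\<in>B. riesz_kernel s0 (x - y) \<partial>lebesgue) * indicator A x) \<partial>lebesgue)"
    unfolding interaction_kernel using inner by (intro nn_integral_mono) (auto simp: indicator_def)
  also have "\<dots> = ennreal \<rho> * interaction s0 A B"
    unfolding interaction_kernel by (intro nn_integral_cmult) measurable
  finally show ?thesis .
qed

text \<open>By \<open>far\<close>, all points at distance at least \<open>\<rho>\<close> from
  \<open>x\<close> belong to \<open>B\<close>, and they contribute exactly \<open>c\<close>. On the
  remaining points of \<open>B\<close> the kernel comparison with \<open>s0\<close> applies.\<close>

lemma interaction_tail_bounds:
  fixes A B :: "'a::euclidean_space set"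
  assumes A: "A \<in> sets lebesgue" and B: "B \<in> sets lebesgue"
    and s: "0 < s" "s \<le> s0" "s0 \<le> s + 1" and \<rho>: "1 \<le> \<rho>"
    and far: "\<And>x y. x \<in> A \<Longrightarrow> \<rho> \<le> norm (x - y) \<Longrightarrow> y \<in> B"
  defines "c \<equiv> ennreal (real DIM('a) * unit_ball_vol (real DIM('a)) * \<rho> powr (- s) / s)"
  shows "c * emeasure lebesgue A \<le> interaction s A B"
    and "interaction s A B \<le> c * emeasure lebesgue A + ennreal \<rho> * interaction s0 A B"
proof -
  note [measurable] = A B kernel_shift_measurable nn_integral_kernel_measurable[OF B]
  define D where "D = (\<lambda>x :: 'a. {y. \<rho> \<le> norm (x - y)})"
  have D[measurable]: "D x \<in> sets lebesgue" for x
  proof -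
    have "D x \<in> sets borel"
      unfolding D_def by measurable
    then show ?thesis
      by simp
  qed
  have c: "(\<integral>\<^sup>+y\<in>D x. riesz_kernel s (x - y) \<partial>lebesgue) = c" for x
    using \<rho> s unfolding D_def c_def by (intro nn_integral_kernel_tail_shift) auto
  have lower: "c \<le> (\<integral>\<^sup>+y\<in>B. riesz_kernel s (x - y) \<partial>lebesgue)" if "x \<in> A" for x
    unfolding c[of x, symmetric]
    using far[OF that] by (intro nn_integral_mono) (auto simp: indicator_def D_def)
  have upper: "(\<integral>\<^sup>+y\<in>B. riesz_kernel s (x - y) \<partial>lebesgue) \<le>
      c + ennreal \<rho> * (\<integral>\<^sup>+y\<in>B. riesz_kernel s0 (x - y) \<partial>lebesgue)" for x
  proof -
    have "(\<integral>\<^sup>+y\<in>B. riesz_kernel s (x - y) \<partial>lebesgue) \<le>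
        (\<integral>\<^sup>+y. riesz_kernel s (x - y) * indicator (D x) y + ennreal \<rho> * (riesz_kernel s0 (x - y) * indicator B y) \<partial>lebesgue)"
    proof (intro nn_integral_mono)
      fix y
      show "riesz_kernel s (x - y) * indicator B y \<le>
          riesz_kernel s (x - y) * indicator (D x) y + ennreal \<rho> * (riesz_kernel s0 (x - y) * indicator B y)"
      proof (cases "y \<in> D x")
        case True
        then show ?thesis
          by (auto simp: indicator_def)
      next
        case False
        then have "norm (x - y) \<le> \<rho>"
          by (simp add: D_def)
        then show ?thesis
          using riesz_kernel_le[OF s(2,3) _ \<rho>] by (auto simp: indicator_def)
      qed
    qed
    also have "\<dots> = c + (\<integral>\<^sup>+y. ennreal \<rho> * (riesz_kernel s0 (x - y) * indicator B y) \<partial>lebesgue)"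
      unfolding c[of x, symmetric] by (intro nn_integral_add) measurable
    also have "(\<integral>\<^sup>+y. ennreal \<rho> * (riesz_kernel s0 (x - y) * indicator B y) \<partial>lebesgue) =
        ennreal \<rho> * (\<integral>\<^sup>+y\<in>B. riesz_kernel s0 (x - y) \<partial>lebesgue)"
      by (intro nn_integral_cmult) measurable
    finally show ?thesis .
  qed
  have "c * emeasure lebesgue A = (\<integral>\<^sup>+x. c * indicator A x \<partial>lebesgue)"
    by (simp add: nn_integral_cmult_indicator)
  also have "\<dots> \<le> interaction s A B"
    unfolding interaction_kernel using lower by (intro nn_integral_mono) (auto simp: indicator_def)
  finally show "c * emeasure lebesgue A \<le> interaction s A B" .
  have "interaction s A B \<le> (\<integral>\<^sup>+x. c * indicator A x +
      ennreal \<rho> * ((\<integral>\<^sup>+y\<in>B. riesz_kernel s0 (x - y) \<partial>lebesgue) * indicator A x) \<partial>lebesgue)"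
    unfolding interaction_kernel using upper by (intro nn_integral_mono) (auto simp: indicator_def)
  also have "\<dots> = (\<integral>\<^sup>+x. c * indicator A x \<partial>lebesgue) +
      (\<integral>\<^sup>+x. ennreal \<rho> * ((\<integral>\<^sup>+y\<in>B. riesz_kernel s0 (x - y) \<partial>lebesgue) * indicator A x) \<partial>lebesgue)"
    by (intro nn_integral_add) measurable
  also have "(\<integral>\<^sup>+x. c * indicator A x \<partial>lebesgue) = c * emeasure lebesgue A"
    by (simp add: nn_integral_cmult_indicator)
  also have "(\<integral>\<^sup>+x. ennreal \<rho> * ((\<integral>\<^sup>+y\<in>B. riesz_kernel s0 (x - y) \<partial>lebesgue) * indicator A x) \<partial>lebesgue) =
      ennreal \<rho> * interaction s0 A B"
    unfolding interaction_kernel by (intro nn_integral_cmult) measurable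
  finally show "interaction s A B \<le> c * emeasure lebesgue A + ennreal \<rho> * interaction s0 A B" .
qed

section \<open>The limit of the rescaled perimeter\<close>

text \<open>Only the interaction with the common complement of \<open>E\<close> and
  \<open>\<Omega>\<close> reaches infinity, and its tail grows like \<open>1 / s\<close>. The rest
  stays bounded by \<open>\<rho> * P\<close>, so a sandwich argument applies after multiplication by
  \<open>s\<close>.\<close>

lemma s_perimeter_tendsto:
  fixes E \<Omega> :: "'a::euclidean_space set"
  assumes E: "E \<in> sets lebesgue" "bounded E" and \<Omega>: "\<Omega> \<in> sets lebesgue" "bounded \<Omega>"
    and s0: "0 < s0" "s0 < 1" "s_perimeter s0 E \<Omega> < \<infinity>"
  shows "((\<lambda>s. ennreal s * s_perimeter s E \<Omega>) \<longlongrightarrow>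
    ennreal (real DIM('a) * unit_ball_vol (real DIM('a))) * emeasure lebesgue (E \<inter> \<Omega>)) (at_right 0)"
proof -
  obtain R0 where R0: "E \<union> \<Omega> \<subseteq> ball 0 R0"
    using E \<Omega> bounded_subset_ballD[of "E \<union> \<Omega>" 0] by auto
  define R where "R = max 1 R0"
  have R: "1 \<le> R" "E \<union> \<Omega> \<subseteq> ball 0 R"
    using R0 by (auto simp: R_def)
  \<comment> \<open>Twice the radius of a ball about 0 containing \<open>E \<union> \<Omega>\<close>
    exceeds all distances within that set; \<open>R\<close> was taken at least 1 so that the kernel
    comparison is available.\<close>
  define \<rho> where "\<rho> = 2 * R"
  have \<rho>: "1 \<le> \<rho>"
    using R by (simp add: \<rho>_def)
  have near: "norm (x - y) < \<rho>" if "x \<in> E \<union> \<Omega>" "y \<in> E \<union> \<Omega>" for x y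
  proof -
    have "norm x < R" "norm y < R"
      using that R(2) by auto
    then show ?thesis
      using norm_triangle_ineq4[of x y] by (simp add: \<rho>_def)
  qed
  note [measurable] = E(1) \<Omega>(1)
  have [measurable]: "- E \<in> sets lebesgue" "- \<Omega> \<in> sets lebesgue"
    using sets.compl_sets[OF E(1)] sets.compl_sets[OF \<Omega>(1)] by (auto simp: Compl_eq_Diff_UNIV)
  define W where "W = real DIM('a) * unit_ball_vol (real DIM('a))"
  have W: "0 \<le> W"
    by (simp add: W_def)
  define P where "P = s_perimeter s0 E \<Omega>"
  define V where "V = emeasure lebesgue (E \<inter> \<Omega>)"
  have V: "V < top"
  proof -
    have "E \<inter> \<Omega> \<in> lmeasurable"
      using E \<Omega> by (intro bounded_set_imp_lmeasurable) (auto intro: bounded_subset)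
    then show ?thesis
      by (simp add: V_def fmeasurable_def)
  qed
  have bounds: "ennreal (W * \<rho> powr (- s) / s) * V \<le> s_perimeter s E \<Omega>"
      "s_perimeter s E \<Omega> \<le> ennreal (W * \<rho> powr (- s) / s) * V + ennreal \<rho> * P"
    if s: "0 < s" "s < s0" for s
  proof -
    have s': "s \<le> s0" "s0 \<le> s + 1"
      using s s0 by auto
    have mid: "ennreal (W * \<rho> powr (- s) / s) * V \<le> interaction s (E \<inter> \<Omega>) (- E \<inter> - \<Omega>)"
      "interaction s (E \<inter> \<Omega>) (- E \<inter> - \<Omega>) \<le>
        ennreal (W * \<rho> powr (- s) / s) * V + ennreal \<rho> * interaction s0 (E \<inter> \<Omega>) (- E \<inter> - \<Omega>)"
    proof -
      have far: "y \<in> - E \<inter> - \<Omega>" if "x \<in> E \<inter> \<Omega>" "\<rho> \<le> norm (x - y)" for x y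
        using near[of x y] that by auto
      have "E \<inter> \<Omega> \<in> sets lebesgue" "- E \<inter> - \<Omega> \<in> sets lebesgue"
        by measurable
      from interaction_tail_bounds[OF this s(1) s' \<rho> far]
      show "ennreal (W * \<rho> powr (- s) / s) * V \<le> interaction s (E \<inter> \<Omega>) (- E \<inter> - \<Omega>)"
        "interaction s (E \<inter> \<Omega>) (- E \<inter> - \<Omega>) \<le>
          ennreal (W * \<rho> powr (- s) / s) * V + ennreal \<rho> * interaction s0 (E \<inter> \<Omega>) (- E \<inter> - \<Omega>)"
        by (simp_all add: W_def V_def)
    qed
    have "ennreal (W * \<rho> powr (- s) / s) * V \<le> interaction s (E \<inter> \<Omega>) (- E \<inter> - \<Omega>)"
      by (rule mid)
    also have "\<dots> \<le> s_perimeter s E \<Omega>"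
      unfolding s_perimeter_def by (simp add: add_increasing add_increasing2)
    finally show "ennreal (W * \<rho> powr (- s) / s) * V \<le> s_perimeter s E \<Omega>" .
    have 1: "interaction s (E \<inter> \<Omega>) (- E \<inter> \<Omega>) \<le> ennreal \<rho> * interaction s0 (E \<inter> \<Omega>) (- E \<inter> \<Omega>)"
      using near by (intro interaction_mono_exponent s' \<rho>) (measurable, force)
    have 3: "interaction s (E \<inter> - \<Omega>) (- E \<inter> \<Omega>) \<le> ennreal \<rho> * interaction s0 (E \<inter> - \<Omega>) (- E \<inter> \<Omega>)"
      using near by (intro interaction_mono_exponent s' \<rho>) (measurable, force)
    have "s_perimeter s E \<Omega> \<le> ennreal \<rho> * interaction s0 (E \<inter> \<Omega>) (- E \<inter> \<Omega>)
        + (ennreal (W * \<rho> powr (- s) / s) * V + ennreal \<rho> * interaction s0 (E \<inter> \<Omega>) (- E \<inter> - \<Omega>))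
        + ennreal \<rho> * interaction s0 (E \<inter> - \<Omega>) (- E \<inter> \<Omega>)"
      unfolding s_perimeter_def by (intro add_mono 1 mid(2) 3)
    also have "\<dots> = ennreal (W * \<rho> powr (- s) / s) * V + ennreal \<rho> * P"
      by (simp add: P_def s_perimeter_def distrib_left ac_simps)
    finally show "s_perimeter s E \<Omega> \<le> ennreal (W * \<rho> powr (- s) / s) * V + ennreal \<rho> * P" .
  qed
  \<comment> \<open>Multiplication by \<open>s\<close> removes the factor \<open>1 / s\<close> of
    the tail; what remains depends on \<open>s\<close> only through
    \<open>\<rho> powr (- s)\<close>, which tends to 1.\<close>
  have cancel: "ennreal s * (ennreal (W * \<rho> powr (- s) / s) * V) = V * ennreal (W * \<rho> powr (- s))" if "0 < s" for s
  proof -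
    have "ennreal s * ennreal (W * \<rho> powr (- s) / s) = ennreal (W * \<rho> powr (- s))"
      using that W by (simp flip: ennreal_mult)
    then show ?thesis
      by (simp add: mult.assoc[symmetric]) (simp add: mult.commute)
  qed
  have ev: "eventually (\<lambda>s. s \<in> {0<..<s0}) (at_right 0)"
    using s0 by (intro eventually_at_right_real) auto
  have "((\<lambda>s. V * ennreal (W * \<rho> powr (- s))) \<longlongrightarrow> V * ennreal (W * \<rho> powr (- 0))) (at_right 0)"
    using \<rho> V by (intro ennreal_tendsto_cmult tendsto_intros) auto
  then have lim1: "((\<lambda>s. V * ennreal (W * \<rho> powr (- s))) \<longlongrightarrow> ennreal W * V) (at_right 0)"
    using \<rho> by (simp add: mult.commute)
  have "((\<lambda>s. (ennreal \<rho> * P) * ennreal s) \<longlongrightarrow> (ennreal \<rho> * P) * ennreal 0) (at_right 0)"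
    using s0(3) by (intro ennreal_tendsto_cmult tendsto_intros) (auto simp: P_def ennreal_mult_less_top)
  then have "((\<lambda>s. (ennreal \<rho> * P) * ennreal s) \<longlongrightarrow> 0) (at_right 0)"
    by simp
  from tendsto_add[OF lim1 this]
  have lim2: "((\<lambda>s. V * ennreal (W * \<rho> powr (- s)) + (ennreal \<rho> * P) * ennreal s) \<longlongrightarrow> ennreal W * V) (at_right 0)"
    by simp
  have "((\<lambda>s. ennreal s * s_perimeter s E \<Omega>) \<longlongrightarrow> ennreal W * V) (at_right 0)"
  proof (rule tendsto_sandwich[OF _ _ lim1 lim2])
    show "eventually (\<lambda>s. V * ennreal (W * \<rho> powr (- s)) \<le> ennreal s * s_perimeter s E \<Omega>) (at_right 0)"
      using ev
    proof eventually_elim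
      case (elim s)
      then have "ennreal s * (ennreal (W * \<rho> powr (- s) / s) * V) \<le> ennreal s * s_perimeter s E \<Omega>"
        by (intro mult_left_mono bounds(1)) auto
      then show ?case
        using elim by (simp add: cancel)
    qed
    show "eventually (\<lambda>s. ennreal s * s_perimeter s E \<Omega> \<le>
        V * ennreal (W * \<rho> powr (- s)) + (ennreal \<rho> * P) * ennreal s) (at_right 0)"
      using ev
    proof eventually_elim
      case (elim s)
      then have "ennreal s * s_perimeter s E \<Omega> \<le>
          ennreal s * (ennreal (W * \<rho> powr (- s) / s) * V + ennreal \<rho> * P)"
        by (intro mult_left_mono bounds(2)) auto
      also have "\<dots> = V * ennreal (W * \<rho> powr (- s)) + (ennreal \<rho> * P) * ennreal s"
        using elim unfolding distrib_left by (subst cancel) (auto simp: mult.commute)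
      finally show ?case .
    qed
  qed
  then show ?thesis
    by (simp add: W_def V_def)
qed

theorem corollary2p6:
  fixes \<Omega> :: "(real ^ 'n) set" and \<gamma> :: real
  assumes "open \<Omega>" and "bounded \<Omega>"
    and "0 < \<gamma>" and "\<gamma> < 1" and "C1_holder_boundary \<gamma> \<Omega>"
  shows "(\<forall>E. E \<in> sets lebesgue \<and> bounded E \<and> (\<exists>s\<^sub>0\<in>{0<..<1}. s_perimeter s\<^sub>0 E \<Omega> < \<infinity>) \<longrightarrow>
            E \<in> limit_class \<Omega> \<and> limit_perimeter \<Omega> E = sphere_weighted_volume (E \<inter> \<Omega>))
       \<and> (\<forall>E. E \<in> sets lebesgue \<and> E \<subseteq> \<Omega> \<and> (\<exists>s\<^sub>0\<in>{0<..<1}. s_perimeter s\<^sub>0 E \<Omega> < \<infinity>) \<longrightarrow>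
            E \<in> limit_class \<Omega> \<and> limit_perimeter \<Omega> E = sphere_weighted_volume E)"
proof -
  have main: "E \<in> limit_class \<Omega> \<and> limit_perimeter \<Omega> E = sphere_weighted_volume (E \<inter> \<Omega>)"
    if E: "E \<in> sets lebesgue" "bounded E" and s0: "s\<^sub>0 \<in> {0<..<1}" "s_perimeter s\<^sub>0 E \<Omega> < \<infinity>"
    for E and s\<^sub>0 :: real
  proof -
    have "sphere_weighted_volume (E \<inter> \<Omega>) =
        ennreal (real CARD('n) * unit_ball_vol (real CARD('n))) * emeasure lebesgue (E \<inter> \<Omega>)"
      using hausdorff_measure_sphere[where 'n = 'n] by (simp add: sphere_weighted_volume_def)
    moreover have "\<Omega> \<in> sets lebesgue"
      using \<open>open \<Omega>\<close> by auto
    ultimately have lim: "((\<lambda>s. ennreal s * s_perimeter s E \<Omega>) \<longlongrightarrow> sphere_weighted_volume (E \<inter> \<Omega>)) (at_right 0)"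
      using s_perimeter_tendsto[OF E _ \<open>bounded \<Omega>\<close>, of s\<^sub>0] s0 by simp
    \<comment> \<open>Membership in \<open>limit_class\<close> asks for a finite limit, so the
      weighted volume has to be shown finite.\<close>
    have "E \<inter> \<Omega> \<in> lmeasurable"
      using E \<open>\<Omega> \<in> sets lebesgue\<close> by (intro bounded_set_imp_lmeasurable) (auto intro: bounded_subset)
    then have "sphere_weighted_volume (E \<inter> \<Omega>) < \<infinity>"
      using hausdorff_measure_sphere[where 'n = 'n]
      by (simp add: sphere_weighted_volume_def ennreal_mult_less_top fmeasurable_def del: emeasure_completion)
    with lim E show ?thesis
      by (auto simp: limit_class_def limit_perimeter_def intro!: tendsto_Lim)
  qed
  show ?thesis
  proof (intro conjI allI impI; elim conjE bexE)
    fix E s\<^sub>0 assume "E \<in> sets lebesgue" "E \<subseteq> \<Omega>" "s\<^sub>0 \<in> {0<..<1}" "s_perimeter s\<^sub>0 E \<Omega> < \<infinity>"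
    \<comment> \<open>A subset of the bounded set \<open>\<Omega>\<close> is bounded, which reduces
      the second claim to \<open>main\<close>.\<close>
    moreover from this have "bounded E" "E \<inter> \<Omega> = E"
      using \<open>bounded \<Omega>\<close> by (auto intro: bounded_subset)
    ultimately show "E \<in> limit_class \<Omega>" "limit_perimeter \<Omega> E = sphere_weighted_volume E"
      using main[of E s\<^sub>0] by auto
  qed (use main in blast)+
qed

end
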